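(* Let $\lambda>0$, $\ell>0$ and let $\gamma\in A_\ell$ be a penalized pinned elastica. If the arclength parametrization of $\gamma$ is $\gamma_{\rm sarc}^{\lambda,\ell,2}$, $\gamma_{\rm larc}^{\lambda,\ell,2}$, or $\gamma_{\rm loop}^{\lambda,\ell,2}$ (whichever is defined), then $\gamma$ is not a local minimizer of $\mathcal{E}_\lambda$ in $A_\ell$.
   Context: Elliptic functions: for $q\in[0,1)$, $x\in\mathbb{R}$, $\mathrm{F}(x,q)=\int_0^x(1-q^2\sin^2\theta)^{-1/2}\,d\theta$, $\mathrm{E}(x,q)=\int_0^x(1-q^2\sin^2\theta)^{1/2}\,d\theta$, $\mathrm{K}(q)=\mathrm{F}(\pi/2,q)$, $\mathrm{E}(q)=\mathrm{E}(\pi/2,q)$; $\mathrm{am}(\cdot,q)$ is the inverse of $x\mapsto\mathrm{F}(x,q)$, $\mathrm{cn}(x,q)=\cos\mathrm{am}(x,q)$. The function $q\mapsto2\mathrm{E}(q)-\mathrm{K}(q)$ is strictly decreasing on $[0,1)$ with unique zero $q_*\in(0,1)$. On $[1/\sqrt2,1)$ let $f(q)=(4q^4-5q^2+1)\mathrm{K}(q)+(-8q^4+8q^2-1)\mathrm{E}(q)$ and $g(q)=8(2\mathrm{E}(q)-\mathrm{K}(q))^2(2q^2-1)$. $f$ has a unique zero $\hat q\in[1/\sqrt2,1)$; $\hat\lambda:=g(\hat q)\approx0.70107$. $g(1/\sqrt2)=0$, $g$ is strictly increasing on $[1/\sqrt2,\hat q]$, strictly decreasing on $[\hat q,q_*]$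 with $g(q_* )=0$, strictly increasing on $[q_*,1)$ with $g\to\infty$ at $1$. For $c\in(0,\hat\lambda]$ let $q_1(c)\in(1/\sqrt2,\hat q]$, $q_2(c)\in[\hat q,q_* )$ solve $g(q)=c$; for $c>0$ let $q_3(c)\in(q_*,1)$ solve $g(q)=c$. Setting: $A_\ell=\{\gamma\in W^{2,2}(0,1;\mathbb{R}^2): |\gamma'|\neq0$ on $[0,1]$, $\gamma(0)=(0,0),\ \gamma(1)=(\ell,0)\}$; $\mathcal{E}_\lambda[\gamma]=\int_\gamma k^2\,ds+\lambda L[\gamma]$. A penalized pinned elastica is $\gamma\in A_\ell$ with $\frac{d}{d\varepsilon}\mathcal{E}_\lambda[\gamma+\varepsilon\eta]|_{\varepsilon=0}=0$ for all $\eta\in W^{2,2}(0,1;\mathbb{R}^2)\cap W^{1,2}_0(0,1;\mathbb{R}^2)$. Local minimizer refers to the $W^{2,2}$-topology. Curves (arclength parametrized on $[0,4\mathrm{K}(q)/\alpha]$): if $\lambda\ell^2\le4\hat\lambda$, $\gamma_{\rm sarc}^{\lambda,\ell,2}(s)=\frac1\alpha\big(2\mathrm{E}(\mathrm{am}(\alpha s-\mathrm{K}(q),q),q)+2\mathrm{E}(q)-\alpha s,\ 2q\,\mathrm{cn}(\alpha s-\mathrm{K}(q),q)\big)$ with $q=q_1(\lambda\ell^2/4)$, $\alpha=\frac{4}{\ell}(2\mathrm{E}(q)-\mathrm{K}(q))$, and $\gamma_{\rm larc}^{\lambda,\ell,2}$ is the same formula with $q=q_2(\lambda\ell^2/4)$;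 $\gamma_{\rm loop}^{\lambda,\ell,2}(s)=\frac1\alpha\big(-2\mathrm{E}(\mathrm{am}(\alpha s-\mathrm{K}(q),q),q)-2\mathrm{E}(q)+\alpha s,\ 2q\,\mathrm{cn}(\alpha s-\mathrm{K}(q),q)\big)$ with $q=q_3(\lambda\ell^2/4)$, $\alpha=\frac{4}{\ell}(\mathrm{K}(q)-2\mathrm{E}(q))$. *)

theory Defs
  imports "HOL-Analysis.Analysis"
begin

definition sint :: "(real \<Rightarrow> real) \<Rightarrow> real \<Rightarrow> real" where
  "sint f x = (if 0 \<le> x then integral {0..x} f else - integral {x..0} f)"

definition ellF :: "real \<Rightarrow> real \<Rightarrow> real" where
  "ellF x q = sint (\<lambda>\<theta>. 1 / sqrt (1 - q^2 * (sin \<theta>)^2)) x"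

definition ellE :: "real \<Rightarrow> real \<Rightarrow> real" where
  "ellE x q = sint (\<lambda>\<theta>. sqrt (1 - q^2 * (sin \<theta>)^2)) x"

definition ellK :: "real \<Rightarrow> real" where
  "ellK q = ellF (pi/2) q"

definition ellEc :: "real \<Rightarrow> real" where
  "ellEc q = ellE (pi/2) q"

definition am :: "real \<Rightarrow> real \<Rightarrow> real" where
  "am u q = (THE x. ellF x q = u)"

definition cn :: "real \<Rightarrow> real \<Rightarrow> real" where
  "cn u q = cos (am u q)"

definition q_star :: real where
  "q_star = (THE q. 0 < q \<and> q < 1 \<and> 2 * ellEc q - ellK q = 0)"

definition f_aux :: "real \<Rightarrow> real" where
  "f_aux q = (4*q^4 - 5*q^2 + 1) * ellK q + (-8*q^4 + 8*q^2 - 1) * ellEc q"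

definition g_aux :: "real \<Rightarrow> real" where
  "g_aux q = 8 * (2 * ellEc q - ellK q)^2 * (2*q^2 - 1)"

definition q_hat :: real where
  "q_hat = (THE q. 1 / sqrt 2 \<le> q \<and> q < 1 \<and> f_aux q = 0)"

definition lambda_hat :: real where
  "lambda_hat = g_aux q_hat"

definition q1 :: "real \<Rightarrow> real" where
  "q1 c = (THE q. 1 / sqrt 2 < q \<and> q \<le> q_hat \<and> g_aux q = c)"

definition q2 :: "real \<Rightarrow> real" where
  "q2 c = (THE q. q_hat \<le> q \<and> q < q_star \<and> g_aux q = c)"

definition q3 :: "real \<Rightarrow> real" where
  "q3 c = (THE q. q_star < q \<and> q < 1 \<and> g_aux q = c)"

section \<open>The explicit curves (arclength parametrized on [0, 4K(q)/alpha])\<close>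

definition arc_curve :: "real \<Rightarrow> real \<Rightarrow> real \<Rightarrow> real \<times> real" where
  "arc_curve q \<alpha> s =
     ((1 / \<alpha>) * (2 * ellE (am (\<alpha> * s - ellK q) q) q + 2 * ellEc q - \<alpha> * s),
      (1 / \<alpha>) * (2 * q * cn (\<alpha> * s - ellK q) q))"

definition loop_curve :: "real \<Rightarrow> real \<Rightarrow> real \<Rightarrow> real \<times> real" where
  "loop_curve q \<alpha> s =
     ((1 / \<alpha>) * (- 2 * ellE (am (\<alpha> * s - ellK q) q) q - 2 * ellEc q + \<alpha> * s),
      (1 / \<alpha>) * (2 * q * cn (\<alpha> * s - ellK q) q))"

definition sarc_q :: "real \<Rightarrow> real \<Rightarrow> real" where
  "sarc_q lam ell = q1 (lam * ell^2 / 4)"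
definition larc_q :: "real \<Rightarrow> real \<Rightarrow> real" where
  "larc_q lam ell = q2 (lam * ell^2 / 4)"
definition loop_q :: "real \<Rightarrow> real \<Rightarrow> real" where
  "loop_q lam ell = q3 (lam * ell^2 / 4)"

definition arc_alpha :: "real \<Rightarrow> real \<Rightarrow> real" where
  "arc_alpha ell q = 4 / ell * (2 * ellEc q - ellK q)"
definition loop_alpha :: "real \<Rightarrow> real \<Rightarrow> real" where
  "loop_alpha ell q = 4 / ell * (ellK q - 2 * ellEc q)"

definition gamma_sarc :: "real \<Rightarrow> real \<Rightarrow> real \<Rightarrow> real \<times> real" where
  "gamma_sarc lam ell = arc_curve (sarc_q lam ell) (arc_alpha ell (sarc_q lam ell))"
definition sarc_len :: "real \<Rightarrow> real \<Rightarrow> real" where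
  "sarc_len lam ell = 4 * ellK (sarc_q lam ell) / arc_alpha ell (sarc_q lam ell)"

definition gamma_larc :: "real \<Rightarrow> real \<Rightarrow> real \<Rightarrow> real \<times> real" where
  "gamma_larc lam ell = arc_curve (larc_q lam ell) (arc_alpha ell (larc_q lam ell))"
definition larc_len :: "real \<Rightarrow> real \<Rightarrow> real" where
  "larc_len lam ell = 4 * ellK (larc_q lam ell) / arc_alpha ell (larc_q lam ell)"

definition gamma_loop :: "real \<Rightarrow> real \<Rightarrow> real \<Rightarrow> real \<times> real" where
  "gamma_loop lam ell = loop_curve (loop_q lam ell) (loop_alpha ell (loop_q lam ell))"
definition loop_len :: "real \<Rightarrow> real \<Rightarrow> real" where
  "loop_len lam ell = 4 * ellK (loop_q lam ell) / loop_alpha ell (loop_q lam ell)"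

text \<open>W^{2,2}(0,1;R^2), via its (continuous) representative: gamma' is absolutely
  continuous with an L^2 derivative, gamma is the integral of gamma'.\<close>
definition W22 :: "(real \<Rightarrow> real \<times> real) \<Rightarrow> bool" where
  "W22 \<gamma> \<longleftrightarrow> (\<exists>u v. v absolutely_integrable_on {0..1} \<and>
      (\<lambda>t. (norm (v t))^2) integrable_on {0..1} \<and>
      (\<forall>t\<in>{0..1}. u t = u 0 + integral {0..t} v) \<and>
      (\<forall>t\<in>{0..1}. \<gamma> t = \<gamma> 0 + integral {0..t} u))"

definition d1 :: "(real \<Rightarrow> real \<times> real) \<Rightarrow> real \<Rightarrow> real \<times> real" where
  "d1 \<gamma> t = vector_derivative \<gamma> (at t within {0..1})"

definition d2 :: "(real \<Rightarrow> real \<times> real) \<Rightarrow> real \<Rightarrow> real \<times> real" where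
  "d2 \<gamma> t = vector_derivative (d1 \<gamma>) (at t within {0..1})"

definition W22_norm :: "(real \<Rightarrow> real \<times> real) \<Rightarrow> real" where
  "W22_norm \<gamma> = sqrt (integral {0..1}
      (\<lambda>t. (norm (\<gamma> t))^2 + (norm (d1 \<gamma> t))^2 + (norm (d2 \<gamma> t))^2))"

definition A_ell :: "real \<Rightarrow> (real \<Rightarrow> real \<times> real) set" where
  "A_ell ell = {\<gamma>. W22 \<gamma> \<and> (\<forall>t\<in>{0..1}. d1 \<gamma> t \<noteq> 0) \<and>
                    \<gamma> 0 = (0, 0) \<and> \<gamma> 1 = (ell, 0)}"

definition curve_length :: "(real \<Rightarrow> real \<times> real) \<Rightarrow> real" where
  "curve_length \<gamma> = integral {0..1} (\<lambda>t. norm (d1 \<gamma> t))"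

text \<open>\<integral>_\<gamma> k^2 ds = \<integral>_0^1 (x'y''-y'x'')^2/|\<gamma>'|^6 * |\<gamma>'| dt\<close>
definition bending :: "(real \<Rightarrow> real \<times> real) \<Rightarrow> real" where
  "bending \<gamma> = integral {0..1} (\<lambda>t.
     (fst (d1 \<gamma> t) * snd (d2 \<gamma> t) - snd (d1 \<gamma> t) * fst (d2 \<gamma> t))^2
       / (norm (d1 \<gamma> t))^6 * norm (d1 \<gamma> t))"

definition energy :: "real \<Rightarrow> (real \<Rightarrow> real \<times> real) \<Rightarrow> real" where
  "energy lam \<gamma> = bending \<gamma> + lam * curve_length \<gamma>"

definition penalized_pinned_elastica :: "real \<Rightarrow> real \<Rightarrow> (real \<Rightarrow> real \<times> real) \<Rightarrow> bool" where
  "penalized_pinned_elastica lam ell \<gamma> \<longleftrightarrow> \<gamma> \<in> A_ell ell \<and>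
     (\<forall>\<eta>. W22 \<eta> \<and> \<eta> 0 = 0 \<and> \<eta> 1 = 0 \<longrightarrow>
        ((\<lambda>e. energy lam (\<lambda>t. \<gamma> t + e *\<^sub>R \<eta> t)) has_real_derivative 0) (at 0))"

definition local_minimizer :: "real \<Rightarrow> real \<Rightarrow> (real \<Rightarrow> real \<times> real) \<Rightarrow> bool" where
  "local_minimizer lam ell \<gamma> \<longleftrightarrow> \<gamma> \<in> A_ell ell \<and>
     (\<exists>\<delta>>0. \<forall>\<gamma>'\<in>A_ell ell. W22_norm (\<lambda>t. \<gamma>' t - \<gamma> t) < \<delta> \<longrightarrow> energy lam \<gamma> \<le> energy lam \<gamma>')"

definition arclen :: "(real \<Rightarrow> real \<times> real) \<Rightarrow> real \<Rightarrow> real" where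
  "arclen \<gamma> t = integral {0..t} (\<lambda>\<tau>. norm (d1 \<gamma> \<tau>))"

definition arclength_param_is :: "(real \<Rightarrow> real \<times> real) \<Rightarrow> (real \<Rightarrow> real \<times> real) \<Rightarrow> real \<Rightarrow> bool" where
  "arclength_param_is \<gamma> c Lc \<longleftrightarrow> curve_length \<gamma> = Lc \<and> (\<forall>t\<in>{0..1}. \<gamma> t = c (arclen \<gamma> t))"

end

theory Submission
  imports Defs
begin

text \<open>
  Each of the three curves is one full period of a wavelike elastica: the extended curve \<open>c\<close> satisfies
  \<open>c (s + L) = c s + (\<ell>, 0)\<close>, and its curvature \<open>k\<close> vanishes at the endpoints. Hence for small
  \<open>e > 0\<close> the shifted curve \<open>c (s + e) - c e\<close> is again admissible, has the same energy and is close to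
  the original, but its curvature \<open>k e\<close> at the endpoints is nonzero, so it violates the natural
  boundary condition: its first variation in the direction \<open>s (s - L) N\<close>, where \<open>N\<close> is the normal
  at \<open>e\<close>, equals \<open>4 L k e\<close>. Arbitrarily close to the original curve there is thus an admissible
  curve of strictly smaller energy.

  The elastica equation enters as the conservation law \<open>(\<lambda> - k\<^sup>2) T - 2 k' N = const\<close>. For modulus
  \<open>q\<close> it amounts to \<open>\<lambda> = 2 \<alpha>\<^sup>2 (2 q\<^sup>2 - 1)\<close>, that is, to \<open>g q = \<lambda> \<ell>\<^sup>2 / 4\<close>, which is available once
  \<open>q\<^sub>1\<close>, \<open>q\<^sub>2\<close>, \<open>q\<^sub>3\<close> are shown to be well defined.
\<close>

section \<open>Indefinite integrals of integrable functions\<close>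

text \<open>The curvature of the given curve vanishes at both endpoints, so the natural boundary
  condition holds there and first-order variations about the curve itself reveal nothing. Sliding
  along the periodic extension costs no energy and leads to a curve that is not critical; a first
  variation there takes the place of a second variation.

  The obstacle is that \<open>\<gamma>\<close> is an arbitrary W^{2,2} parametrization of the
  explicit curve, while closeness is measured in the parameter on [0,1]. Every competitor is
  therefore composed with the same arclength function \<open>\<sigma>\<close> of
  \<open>\<gamma>\<close>, which reduces closeness to a uniform C^2 bound in arclength. This needs
  \<open>\<sigma>\<close> itself to be in W^{2,2}, that is, a speed with square integrable
  derivative, and hence a product rule for a factor that is merely absolutely continuous.

  The moduli are treated in the variable \<open>w = q^2\<close>, where 2E - K is decreasing and
  concave; the critical points of g and its monotonicity then follow from signs alone.\<close>

lemma ae_right_derivative: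
  fixes f :: "real \<Rightarrow> 'b::euclidean_space"
  assumes "\<And>a b. f integrable_on {a..b}"
  obtains N where "negligible N"
    "\<And>x e. x \<notin> N \<Longrightarrow> 0 < e \<Longrightarrow>
      \<exists>d>0. \<forall>h. 0 < h \<and> h < d \<longrightarrow> norm (integral {x..x+h} f - h *\<^sub>R f x) \<le> e * h"
proof -
  obtain N where N: "negligible N" "\<And>x e. \<lbrakk>x \<notin> N; 0 < e\<rbrakk> \<Longrightarrow>
      \<exists>d>0. \<forall>h. 0 < h \<and> h < d \<longrightarrow>
         norm (integral (cbox x (x + h *\<^sub>R One)) f /\<^sub>R h ^ DIM(real) - f x) < e"
    using integrable_ccontinuous_explicit[of f] assms by auto
  show ?thesis
  proof (rule that[OF N(1)])
    fix x e :: real assume "x \<notin> N" "0 < e"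
    then obtain d where d: "d > 0" "\<And>h. 0 < h \<Longrightarrow> h < d \<Longrightarrow> norm (integral {x..x+h} f /\<^sub>R h - f x) < e"
      using N(2)[of x e] by auto
    have "norm (integral {x..x+h} f - h *\<^sub>R f x) \<le> e * h" if "0 < h" "h < d" for h
    proof -
      have "integral {x..x+h} f - h *\<^sub>R f x = h *\<^sub>R (integral {x..x+h} f /\<^sub>R h - f x)"
        using that by (simp add: algebra_simps)
      then show ?thesis
        using d(2)[OF that] that by (simp add: mult.commute mult_left_mono less_imp_le)
    qed
    then show "\<exists>d>0. \<forall>h. 0 < h \<and> h < d \<longrightarrow> norm (integral {x..x+h} f - h *\<^sub>R f x) \<le> e * h"
      using d(1) by blast
  qed
qed

lemma negligible_uminus:
  fixes N :: "real set"
  assumes "negligible N"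
  shows "negligible (uminus ` N)"
  by (rule negligible_differentiable_image_negligible[OF order_refl assms])
    (auto intro!: derivative_intros)

text \<open>The differentiation theorem for box averages has \<open>x\<close> at the lower corner of
  the box, so on the line it yields right derivatives only. Left derivatives come from the same
  theorem for the reflected function; the exceptional set is the union of the two null sets, the
  second one reflected back.\<close>

lemma indefinite_integral_ae_vector_derivative:
  fixes v :: "real \<Rightarrow> 'b::euclidean_space"
  assumes v: "v integrable_on {a..b}"
  obtains N where "negligible N"
    "\<And>t. t \<in> {a..b} - N \<Longrightarrow>
      ((\<lambda>x. integral {a..x} v) has_vector_derivative v t) (at t within {a..b})"
proof -
  \<comment> \<open>Extension by zero makes the function integrable on every interval, also on those
    that reach beyond \<open>a\<close> or \<open>b\<close>.\<close>
  define f where "f = (\<lambda>x. if x \<in> {a..b} then v x else 0)"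
  have fU: "f integrable_on UNIV"
    unfolding f_def using v by (subst integrable_restrict_UNIV)
  have f: "f integrable_on {c..d}" for c d
    using integrable_on_subcbox[OF fU, of c d] by simp
  have "(\<lambda>x. f (-x)) integrable_on {c..d}" for c d
    using f[of "-d" "-c"] Henstock_Kurzweil_Integration.integrable_reflect_real[where f=f and a="-d" and b="-c"] by simp
  then obtain N2 where N2: "negligible N2"
    "\<And>x e. x \<notin> N2 \<Longrightarrow> 0 < e \<Longrightarrow>
      \<exists>d>0. \<forall>h. 0 < h \<and> h < d \<longrightarrow> norm (integral {x..x+h} (\<lambda>x. f (-x)) - h *\<^sub>R f (-x)) \<le> e * h"
    using ae_right_derivative[of "\<lambda>x. f (-x)"] by auto
  obtain N1 where N1: "negligible N1"
    "\<And>x e. x \<notin> N1 \<Longrightarrow> 0 < e \<Longrightarrow>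
      \<exists>d>0. \<forall>h. 0 < h \<and> h < d \<longrightarrow> norm (integral {x..x+h} f - h *\<^sub>R f x) \<le> e * h"
    using ae_right_derivative[of f] f by auto
  show ?thesis
  proof (rule that)
    show "negligible (N1 \<union> uminus ` N2)"
      by (intro negligible_Un N1 negligible_uminus N2)
    fix t assume t: "t \<in> {a..b} - (N1 \<union> uminus ` N2)"
    then have tN: "t \<notin> N1" "- t \<notin> N2" and tab: "a \<le> t" "t \<le> b"
      by (auto simp: image_iff)
    have fv: "integral {c..d} f = integral {c..d} v" if "{c..d} \<subseteq> {a..b}" for c d
      by (rule integral_cong) (use that in \<open>auto simp: f_def\<close>)
    have ft: "f t = v t" using tab by (simp add: f_def)
    show "((\<lambda>x. integral {a..x} v) has_vector_derivative v t) (at t within {a..b})"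
      unfolding has_vector_derivative_def has_derivative_within_alt
    proof (intro conjI allI impI)
      show "bounded_linear (\<lambda>x. x *\<^sub>R v t)" by (rule bounded_linear_scaleR_left)
      fix e :: real assume e: "0 < e"
      obtain d1 where d1: "d1 > 0" "\<And>h. 0 < h \<Longrightarrow> h < d1 \<Longrightarrow> norm (integral {t..t+h} f - h *\<^sub>R f t) \<le> e * h"
        using N1(2)[OF tN(1) e] by blast
      obtain d2 where d2: "d2 > 0" "\<And>h. 0 < h \<Longrightarrow> h < d2 \<Longrightarrow> 
           norm (integral {-t..-t+h} (\<lambda>x. f (-x)) - h *\<^sub>R f t) \<le> e * h"
        using N2(2)[OF tN(2) e] by auto
      have "norm (integral {a..y} v - integral {a..t} v - (y - t) *\<^sub>R v t) \<le> e * norm (y - t)"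
        if y: "y \<in> {a..b}" "norm (y - t) < min d1 d2" for y
      proof -
        consider "y = t" | "t < y" | "y < t" by linarith
        then show ?thesis
        proof cases
          case 1 then show ?thesis by simp
        next
          case 2
          have "integral {a..t} v + integral {t..y} v = integral {a..y} v"
            by (rule Henstock_Kurzweil_Integration.integral_combine)
              (use 2 tab y in \<open>auto intro: integrable_on_subinterval[OF v]\<close>)
          moreover have "integral {t..y} f = integral {t..y} v"
            by (rule fv) (use tab y in auto)
          moreover have "norm (integral {t..y} f - (y - t) *\<^sub>R f t) \<le> e * (y - t)"
            using d1(2)[of "y - t"] 2 y by auto
          ultimately show ?thesis using ft 2 by (metis abs_of_pos add_diff_cancel_left' diff_gt_0_iff_gt real_norm_def)
        next
          case 3
          have "integral {a..y} v + integral {y..t} v = integral {a..t} v"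
            by (rule Henstock_Kurzweil_Integration.integral_combine)
              (use 3 tab y in \<open>auto intro: integrable_on_subinterval[OF v]\<close>)
          moreover have "integral {y..t} f = integral {y..t} v"
            by (rule fv) (use tab y in auto)
          moreover have "integral {-t..-y} (\<lambda>x. f (-x)) = integral {y..t} f"
            by (rule Henstock_Kurzweil_Integration.integral_reflect_real)
          moreover have "norm (integral {-t..-y} (\<lambda>x. f (-x)) - (t - y) *\<^sub>R f t) \<le> e * (t - y)"
            using d2(2)[of "t - y"] 3 y by auto
          ultimately have "norm (integral {a..t} v - integral {a..y} v - (t - y) *\<^sub>R v t) \<le> e * (t - y)"
            using ft by (metis add_diff_cancel_left')
          moreover have "integral {a..y} v - integral {a..t} v - (y - t) *\<^sub>R v t
             = - (integral {a..t} v - integral {a..y} v - (t - y) *\<^sub>R v t)"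
            by (simp add: algebra_simps)
          ultimately show ?thesis using 3 by (simp only: norm_minus_cancel) simp
        qed
      qed
      then show "\<exists>d>0. \<forall>y\<in>{a..b}. norm (y - t) < d \<longrightarrow>
          norm (integral {a..y} v - integral {a..t} v - (y - t) *\<^sub>R v t) \<le> e * norm (y - t)"
        using d1(1) d2(1) by (intro exI[of _ "min d1 d2"]) auto
    qed
  qed
qed

text \<open>Integration by parts with one factor absolutely continuous and the other C^1. The
  product is a general bounded bilinear map because it is applied to scalar multiplication (second
  derivative of a composed curve) and to the inner product (derivative of the speed).\<close>

lemma indefinite_integral_product:
  fixes u v :: "real \<Rightarrow> 'a::euclidean_space" and w w' :: "real \<Rightarrow> 'b::euclidean_space"
    and prod :: "'a \<Rightarrow> 'b \<Rightarrow> 'c::euclidean_space"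
  assumes prod: "bounded_bilinear prod"
    and v: "v absolutely_integrable_on {a..b}"
    and u: "\<And>t. t \<in> {a..b} \<Longrightarrow> u t = u a + integral {a..t} v"
    and w: "\<And>t. t \<in> {a..b} \<Longrightarrow> (w has_vector_derivative w' t) (at t within {a..b})"
    and w': "continuous_on {a..b} w'"
  shows "(\<lambda>s. prod (v s) (w s) + prod (u s) (w' s)) absolutely_integrable_on {a..b}"
    and "t \<in> {a..b} \<Longrightarrow> prod (u t) (w t) = prod (u a) (w a)
           + integral {a..t} (\<lambda>s. prod (v s) (w s) + prod (u s) (w' s))"
proof -
  let ?J = "\<lambda>s. prod (v s) (w s) + prod (u s) (w' s)"
  interpret bounded_bilinear prod by fact
  have vi: "v integrable_on {a..b}"
    using v set_lebesgue_integral_eq_integral(1) by blast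
  have nvi: "(\<lambda>x. norm (v x)) integrable_on {a..b}"
    using v by (simp add: absolutely_integrable_on_def)
  have cw: "continuous_on {a..b} w"
    by (rule continuous_on_vector_derivative[OF w])
  have cu: "continuous_on {a..b} u"
    by (rule continuous_on_eq[OF continuous_on_add[OF continuous_on_const[of _ "u a"] indefinite_integral_continuous_1[OF vi]]])
      (simp add: u[symmetric])
  have J1: "(\<lambda>s. prod (v s) (w s)) absolutely_integrable_on {a..b}"
  proof (rule absolutely_integrable_bounded_measurable_product[where h="\<lambda>x y. prod y x"])
    show "bilinear (\<lambda>x y. prod y x)"
      using bounded_bilinear.flip[OF prod] by (simp add: bilinear_conv_bounded_bilinear)
    show "bounded (w ` {a..b})"
      by (intro compact_imp_bounded compact_continuous_image cw) simp
    show "w \<in> borel_measurable (lebesgue_on {a..b})"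
      by (rule continuous_imp_measurable_on_sets_lebesgue[OF cw]) simp
  qed (use v in auto)
  have J2: "(\<lambda>s. prod (u s) (w' s)) absolutely_integrable_on {a..b}"
    by (intro absolutely_integrable_continuous_real continuous_on cu w')
  show J: "?J absolutely_integrable_on {a..b}"
    by (rule set_integral_add(1)[OF J1 J2])
  then have Ji: "?J integrable_on {a..b}"
    using set_lebesgue_integral_eq_integral(1) by blast
  obtain K where K: "K > 0" "\<And>x y. norm (prod x y) \<le> norm x * norm y * K"
    using pos_bounded by blast
  have "bounded (w' ` {a..b})"
    by (intro compact_imp_bounded compact_continuous_image w') simp
  then obtain M where M: "M > 0" "\<And>s. s \<in> {a..b} \<Longrightarrow> norm (w' s) \<le> M"
    by (metis bounded_pos imageI)
  define V where "V t = integral {a..t} (\<lambda>x. norm (v x))" for t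
  define Z where "Z t = prod (u t) (w t) - integral {a..t} ?J" for t
  have wint: "(w' has_integral (w y - w x)) {x..y}" if "a \<le> x" "x \<le> y" "y \<le> b" for x y
    by (rule fundamental_theorem_of_calculus)
      (use that in \<open>auto intro!: has_vector_derivative_within_subset[OF w]\<close>)
  have wlip: "norm (w y - w x) \<le> M * (y - x)" if "a \<le> x" "x \<le> y" "y \<le> b" for x y
    using has_integral_bound_real[OF _ _ wint[OF that], of M "{}"] M that by auto
  \<comment> \<open>Both factors on the right vanish as \<open>y\<close> tends to \<open>x\<close>, so \<open>Z\<close> has derivative zero everywhere; this
    replaces Fubini's theorem.\<close>
  have main: "norm (Z y - Z x) \<le> 2 * K * M * (y - x) * (V y - V x)" if xy: "a \<le> x" "x \<le> y" "y \<le> b" for x y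
  proof -
    have sub: "{x..y} \<subseteq> {a..b}" using xy by auto
    have vxy: "v integrable_on {x..y}" and nvxy: "(\<lambda>x. norm (v x)) integrable_on {x..y}"
      and Jxy: "?J integrable_on {x..y}"
      by (rule integrable_on_subinterval[OF _ sub]; fact)+
    have splitJ: "integral {a..x} ?J + integral {x..y} ?J = integral {a..y} ?J"
      by (rule Henstock_Kurzweil_Integration.integral_combine)
        (use xy in \<open>auto intro: integrable_on_subinterval[OF Ji]\<close>)
    have splitV: "integral {a..x} (\<lambda>x. norm (v x)) + integral {x..y} (\<lambda>x. norm (v x)) = integral {a..y} (\<lambda>x. norm (v x))"
      by (rule Henstock_Kurzweil_Integration.integral_combine)
        (use xy in \<open>auto intro: integrable_on_subinterval[OF nvi]\<close>)
    have uxy: "u z - u x = integral {x..z} v" if "z \<in> {x..y}" for z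
    proof -
      have "integral {a..x} v + integral {x..z} v = integral {a..z} v"
        by (rule Henstock_Kurzweil_Integration.integral_combine)
          (use xy that in \<open>auto intro: integrable_on_subinterval[OF vi]\<close>)
      then show ?thesis using u[of z] u[of x] xy that by (simp add: algebra_simps)
    qed
    have h1: "((\<lambda>s. prod (v s) (w y)) has_integral prod (u y - u x) (w y)) {x..y}"
      using has_integral_linear[OF integrable_integral[OF vxy] bounded_linear_left[of "w y"]] uxy[of y] xy
      unfolding o_def by auto
    have h2: "((\<lambda>s. prod (u x) (w' s)) has_integral prod (u x) (w y - w x)) {x..y}"
      using has_integral_linear[OF wint[OF xy] bounded_linear_right[of "u x"]] unfolding o_def .
    have h3: "(?J has_integral (integral {a..y} ?J - integral {a..x} ?J)) {x..y}"
      using integrable_integral[OF Jxy] unfolding splitJ[symmetric] by simp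
    \<comment> \<open>With \<open>w\<close> frozen at \<open>y\<close> and \<open>u\<close> frozen
      at \<open>x\<close>, the first two terms integrate exactly to the increment of
      \<open>prod (u t) (w t)\<close>. Hence \<open>Z y - Z x\<close> is the integral of the
      freezing error alone.\<close>
    have h: "((\<lambda>s. prod (v s) (w y) + prod (u x) (w' s) - ?J s) has_integral (Z y - Z x)) {x..y}"
    proof (rule has_integral_eq_rhs[OF has_integral_diff[OF has_integral_add[OF h1 h2] h3]])
      show "Z y - Z x = prod (u y - u x) (w y) + prod (u x) (w y - w x) - (integral {a..y} ?J - integral {a..x} ?J)"
        by (simp add: Z_def diff_left diff_right algebra_simps)
    qed
    have VV: "integral {x..y} (\<lambda>x. norm (v x)) = V y - V x"
      unfolding V_def using splitV by linarith
    have bnd: "norm (prod (v s) (w y) + prod (u x) (w' s) - ?J s)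
       \<le> K * M * (y - x) * norm (v s) + K * M * (V y - V x)" if s: "s \<in> {x..y}" for s
    proof -
      have "prod (v s) (w y) + prod (u x) (w' s) - ?J s = prod (v s) (w y - w s) - prod (u s - u x) (w' s)"
        by (simp add: diff_left diff_right)
      also have "norm \<dots> \<le> norm (prod (v s) (w y - w s)) + norm (prod (u s - u x) (w' s))"
        by (rule norm_triangle_ineq4)
      also have "norm (prod (v s) (w y - w s)) \<le> norm (v s) * norm (w y - w s) * K" by (rule K)
      also have "\<dots> \<le> norm (v s) * (M * (y - x)) * K"
      proof (intro mult_right_mono mult_left_mono)
        have "norm (w y - w s) \<le> M * (y - s)" using wlip s xy by auto
        also have "\<dots> \<le> M * (y - x)" using s M(1) by auto
        finally show "norm (w y - w s) \<le> M * (y - x)" .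
      qed (use K in auto)
      also have "norm (prod (u s - u x) (w' s)) \<le> norm (u s - u x) * norm (w' s) * K" by (rule K)
      also have "\<dots> \<le> (V y - V x) * M * K"
      proof (intro mult_right_mono mult_mono)
        have "norm (u s - u x) \<le> integral {x..s} (\<lambda>x. norm (v x))"
          unfolding uxy[OF s]
          by (rule integral_norm_bound_integral) (use s in \<open>auto intro: integrable_on_subinterval[OF vxy] integrable_on_subinterval[OF nvxy]\<close>)
        also have "\<dots> \<le> integral {x..y} (\<lambda>x. norm (v x))"
          by (rule integral_subset_le) (use s in \<open>auto intro: integrable_on_subinterval[OF nvxy] nvxy\<close>)
        finally show A: "norm (u s - u x) \<le> V y - V x" unfolding VV .
        show "0 \<le> V y - V x" using A norm_ge_zero order_trans by blast
        show "norm (w' s) \<le> M" using M s xy by auto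
      qed (use K in auto)
      finally show ?thesis by (simp add: algebra_simps)
    qed
    have hb: "((\<lambda>s. K * M * (y - x) * norm (v s) + K * M * (V y - V x)) has_integral
        (K * M * (y - x) * (V y - V x) + (y - x) * (K * M * (V y - V x)))) {x..y}"
      using has_integral_add[OF has_integral_mult_right[OF integrable_integral[OF nvxy], of "K * M * (y - x)"]
        has_integral_const_real[of "K * M * (V y - V x)" x y]] xy VV by simp
    have "norm (Z y - Z x) \<le> K * M * (y - x) * (V y - V x) + (y - x) * (K * M * (V y - V x))"
      using integral_norm_bound_integral[OF has_integral_integrable[OF h] has_integral_integrable[OF hb] bnd]
      by (simp add: integral_unique[OF h] integral_unique[OF hb])
    then show ?thesis by (simp add: algebra_simps)
  qed
  have cV: "continuous_on {a..b} V"
    unfolding V_def by (rule indefinite_integral_continuous_1[OF nvi])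
  have "(Z has_derivative (\<lambda>h. 0)) (at x within {a..b})" if x: "x \<in> {a..b}" for x
    unfolding has_derivative_within_alt
  proof (intro conjI allI impI)
    fix e :: real assume "0 < e"
    then have "e / (2 * K * M) > 0" using K M by simp
    then obtain d where d: "d > 0" "\<And>y. y \<in> {a..b} \<Longrightarrow> dist y x < d \<Longrightarrow> dist (V y) (V x) < e / (2 * K * M)"
      using cV x unfolding continuous_on_iff by blast
    have "norm (Z y - Z x - 0) \<le> e * norm (y - x)" if y: "y \<in> {a..b}" "norm (y - x) < d" for y
    proof -
      have "norm (Z y - Z x) \<le> 2 * K * M * \<bar>y - x\<bar> * \<bar>V y - V x\<bar>"
      proof (cases "x \<le> y")
        case True
        have "norm (Z y - Z x) \<le> 2 * K * M * (y - x) * (V y - V x)"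
          using main[of x y] x y True by simp
        also have "\<dots> \<le> 2 * K * M * (y - x) * \<bar>V y - V x\<bar>"
          using True K M by (intro mult_left_mono) auto
        finally show ?thesis using True by simp
      next
        case False
        have "norm (Z x - Z y) \<le> 2 * K * M * (x - y) * (V x - V y)"
          using main[of y x] x y False by simp
        also have "\<dots> \<le> 2 * K * M * (x - y) * \<bar>V y - V x\<bar>"
          using False K M by (intro mult_left_mono) auto
        finally show ?thesis using False by (simp add: norm_minus_commute)
      qed
      also have "\<dots> \<le> 2 * K * M * \<bar>y - x\<bar> * (e / (2 * K * M))"
        using d(2)[of y] y K M by (intro mult_left_mono) (auto simp: dist_real_def)
      also have "\<dots> = e * norm (y - x)" using K M by simp
      finally show ?thesis by simp
    qed
    then show "\<exists>d>0. \<forall>y\<in>{a..b}. norm (y - x) < d \<longrightarrow> norm (Z y - Z x - 0) \<le> e * norm (y - x)"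
      using d(1) by blast
  qed simp
  then obtain c where c: "\<And>x. x \<in> {a..b} \<Longrightarrow> Z x = c"
    using has_derivative_zero_constant[of "{a..b}" Z] by auto
  assume t: "t \<in> {a..b}"
  then have "Z t = Z a" using c[of t] c[of a] by auto
  then show "prod (u t) (w t) = prod (u a) (w a) + integral {a..t} ?J"
    by (simp add: Z_def algebra_simps)
qed

section \<open>Sobolev curves and their energies\<close>

text \<open>The witnesses hidden in \<open>W22\<close> made explicit: \<open>u\<close> and
  \<open>v\<close> are the weak first and second derivatives. Unlike the pointwise \<open>d1\<close>
  and \<open>d2\<close> they can be given by formulas and transformed.\<close>

definition W22_rep :: "(real \<Rightarrow> real \<times> real) \<Rightarrow> (real \<Rightarrow> real \<times> real) \<Rightarrow> (real \<Rightarrow> real \<times> real) \<Rightarrow> bool" where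
  "W22_rep \<gamma> u v \<longleftrightarrow> v absolutely_integrable_on {0..1} \<and>
      (\<lambda>t. (norm (v t))^2) integrable_on {0..1} \<and>
      (\<forall>t\<in>{0..1}. u t = u 0 + integral {0..t} v) \<and>
      (\<forall>t\<in>{0..1}. \<gamma> t = \<gamma> 0 + integral {0..t} u)"

lemma W22_iff_rep: "W22 \<gamma> \<longleftrightarrow> (\<exists>u v. W22_rep \<gamma> u v)"
  by (simp add: W22_def W22_rep_def)

lemma W22_repD:
  assumes "W22_rep \<gamma> u v"
  shows "v absolutely_integrable_on {0..1}" "(\<lambda>t. (norm (v t))^2) integrable_on {0..1}"
    "t \<in> {0..1} \<Longrightarrow> u t = u 0 + integral {0..t} v"
    "t \<in> {0..1} \<Longrightarrow> \<gamma> t = \<gamma> 0 + integral {0..t} u"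
  using assms unfolding W22_rep_def by blast+

lemma W22_rep_cong:
  assumes "W22_rep \<gamma> u v" "\<And>t. t \<in> {0..1} \<Longrightarrow> \<gamma>' t = \<gamma> t"
  shows "W22_rep \<gamma>' u v"
  unfolding W22_rep_def
proof (intro conjI ballI)
  fix t :: real assume t: "t \<in> {0..1}"
  have "\<gamma> t = \<gamma> 0 + integral {0..t} u" by (rule W22_repD(4)[OF assms(1) t])
  then show "\<gamma>' t = \<gamma>' 0 + integral {0..t} u"
    using assms(2)[OF t] assms(2)[of 0] by simp
qed (rule W22_repD[OF assms(1)], assumption?)+

lemma W22_rep_continuous:
  assumes "W22_rep \<gamma> u v"
  shows "continuous_on {0..1} u"
proof -
  have v: "v integrable_on {0..1}"
    by (rule set_lebesgue_integral_eq_integral(1)[OF W22_repD(1)[OF assms]])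
  show ?thesis
    by (rule continuous_on_eq[OF continuous_on_add[OF continuous_on_const[of _ "u 0"] indefinite_integral_continuous_1[OF v]]])
      (rule W22_repD(3)[OF assms, symmetric])
qed

lemma W22_rep_derivative:
  assumes "W22_rep \<gamma> u v" "t \<in> {0..1}"
  shows "(\<gamma> has_vector_derivative u t) (at t within {0..1})"
proof -
  have "((\<lambda>t. \<gamma> 0 + integral {0..t} u) has_vector_derivative u t) (at t within {0..1})"
    using has_vector_derivative_add[OF has_vector_derivative_const
        integral_has_vector_derivative[OF W22_rep_continuous[OF assms(1)] assms(2)], of "\<gamma> 0"] by simp
  then show ?thesis
    by (rule has_vector_derivative_transform[OF assms(2) W22_repD(4)[OF assms(1)], rotated])
qed

lemma W22_rep_d1:
  assumes "W22_rep \<gamma> u v" "t \<in> {0..1}"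
  shows "d1 \<gamma> t = u t"
  unfolding d1_def
  by (rule vector_derivative_within_closed_interval)
    (use assms W22_rep_derivative[OF assms] in auto)

text \<open>\<^const>\<open>d2\<close> is a pointwise derivative with an arbitrary value where \<^const>\<open>d1\<close> is not
  differentiable; Lebesgue's differentiation theorem confines these points to a null set.\<close>

lemma W22_rep_d2:
  assumes "W22_rep \<gamma> u v"
  obtains N where "negligible N" "\<And>t. t \<in> {0..1} - N \<Longrightarrow> d2 \<gamma> t = v t"
proof -
  have "v integrable_on {0..1}"
    by (rule set_lebesgue_integral_eq_integral(1)[OF W22_repD(1)[OF assms]])
  then obtain N where N: "negligible N"
    "\<And>t. t \<in> {0..1} - N \<Longrightarrow> ((\<lambda>x. integral {0..x} v) has_vector_derivative v t) (at t within {0..1})"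
    using indefinite_integral_ae_vector_derivative by blast
  show ?thesis
  proof (rule that[OF N(1)])
    fix t :: real assume t: "t \<in> {0..1} - N"
    have "((\<lambda>x. u 0 + integral {0..x} v) has_vector_derivative v t) (at t within {0..1})"
      using has_vector_derivative_add[OF has_vector_derivative_const N(2)[OF t], of "u 0"] by simp
    then have "(d1 \<gamma> has_vector_derivative v t) (at t within {0..1})"
      by (rule has_vector_derivative_transform[rotated 2])
        (use t in \<open>auto simp: W22_rep_d1[OF assms] intro: W22_repD(3)[OF assms]\<close>)
    then show "d2 \<gamma> t = v t"
      unfolding d2_def
      by (intro vector_derivative_within_closed_interval) (use t in auto)
  qed
qed

definition cross2 :: "real \<times> real \<Rightarrow> real \<times> real \<Rightarrow> real" where
  "cross2 a b = fst a * snd b - snd a * fst b"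

lemma W22_rep_bending:
  assumes "W22_rep \<gamma> u v"
  shows "bending \<gamma> = integral {0..1} (\<lambda>t. (cross2 (u t) (v t))^2 / (norm (u t))^6 * norm (u t))"
proof -
  obtain N where N: "negligible N" "\<And>t. t \<in> {0..1} - N \<Longrightarrow> d2 \<gamma> t = v t"
    using W22_rep_d2[OF assms] by blast
  show ?thesis
    unfolding bending_def
    by (rule integral_spike[OF N(1)]) (simp add: N(2) W22_rep_d1[OF assms] cross2_def)
qed

lemma W22_rep_length:
  assumes "W22_rep \<gamma> u v"
  shows "curve_length \<gamma> = integral {0..1} (\<lambda>t. norm (u t))"
  unfolding curve_length_def by (rule integral_cong) (simp add: W22_rep_d1[OF assms])

lemma W22_rep_norm:
  assumes "W22_rep \<gamma> u v"
  shows "W22_norm \<gamma> = sqrt (integral {0..1} (\<lambda>t. (norm (\<gamma> t))^2 + (norm (u t))^2 + (norm (v t))^2))"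
proof -
  obtain N where N: "negligible N" "\<And>t. t \<in> {0..1} - N \<Longrightarrow> d2 \<gamma> t = v t"
    using W22_rep_d2[OF assms] by blast
  have "integral {0..1} (\<lambda>t. (norm (\<gamma> t))^2 + (norm (d1 \<gamma> t))^2 + (norm (d2 \<gamma> t))^2) =
    integral {0..1} (\<lambda>t. (norm (\<gamma> t))^2 + (norm (u t))^2 + (norm (v t))^2)"
    by (rule integral_spike[OF N(1)]) (simp add: N(2) W22_rep_d1[OF assms])
  then show ?thesis unfolding W22_norm_def by simp
qed

section \<open>Changes of parameter within W^{2,2}\<close>

text \<open>\<open>r\<close> is the speed and \<open>\<rho>\<close> its weak derivative. The
  conditions keep the composition with a C^2 curve in W^{2,2} and make \<open>\<sigma>\<close>
  strictly increasing from 0.\<close>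

definition reparametrization :: "(real \<Rightarrow> real) \<Rightarrow> (real \<Rightarrow> real) \<Rightarrow> (real \<Rightarrow> real) \<Rightarrow> bool" where
  "reparametrization \<sigma> r \<rho> \<longleftrightarrow> \<rho> absolutely_integrable_on {0..1} \<and>
     (\<lambda>t. (\<rho> t)^2) integrable_on {0..1} \<and>
     (\<forall>t\<in>{0..1}. r t = r 0 + integral {0..t} \<rho>) \<and>
     (\<forall>t\<in>{0..1}. \<sigma> t = integral {0..t} r) \<and>
     (\<forall>t\<in>{0..1}. r t > 0)"

lemma reparametrizationD:
  assumes "reparametrization \<sigma> r \<rho>"
  shows "\<rho> absolutely_integrable_on {0..1}" "(\<lambda>t. (\<rho> t)^2) integrable_on {0..1}"
    "t \<in> {0..1} \<Longrightarrow> r t = r 0 + integral {0..t} \<rho>"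
    "t \<in> {0..1} \<Longrightarrow> \<sigma> t = integral {0..t} r"
    "t \<in> {0..1} \<Longrightarrow> r t > 0"
  using assms unfolding reparametrization_def by blast+

lemma reparametrization_continuous:
  assumes "reparametrization \<sigma> r \<rho>"
  shows "continuous_on {0..1} r"
proof -
  have v: "\<rho> integrable_on {0..1}"
    by (rule set_lebesgue_integral_eq_integral(1)[OF reparametrizationD(1)[OF assms]])
  show ?thesis
    by (rule continuous_on_eq[OF continuous_on_add[OF continuous_on_const[of _ "r 0"] indefinite_integral_continuous_1[OF v]]])
      (rule reparametrizationD(3)[OF assms, symmetric])
qed

lemma reparametrization_derivative:
  assumes "reparametrization \<sigma> r \<rho>" "t \<in> {0..1}"
  shows "(\<sigma> has_vector_derivative r t) (at t within {0..1})"
  by (rule has_vector_derivative_transform[OF assms(2) reparametrizationD(4)[OF assms(1)]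
        integral_has_vector_derivative[OF reparametrization_continuous[OF assms(1)] assms(2)]])

lemma reparametrization_mono:
  assumes "reparametrization \<sigma> r \<rho>" "0 \<le> s" "s \<le> t" "t \<le> 1"
  shows "\<sigma> s \<le> \<sigma> t"
proof -
  have "(r has_integral (\<sigma> t - \<sigma> s)) {s..t}"
    by (rule fundamental_theorem_of_calculus)
      (use assms in \<open>auto intro: has_vector_derivative_within_subset[OF reparametrization_derivative]\<close>)
  then have "0 \<le> \<sigma> t - \<sigma> s"
    by (rule has_integral_nonneg)
      (use assms in \<open>auto intro!: less_imp_le reparametrizationD(5)[OF assms(1)]\<close>)
  then show ?thesis by simp
qed

lemma reparametrization_range:
  assumes "reparametrization \<sigma> r \<rho>"
  shows "\<sigma> 0 = 0" "t \<in> {0..1} \<Longrightarrow> \<sigma> t \<in> {0..\<sigma> 1}"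
proof -
  show *: "\<sigma> 0 = 0" using reparametrizationD(4)[OF assms, of 0] by simp
  show "t \<in> {0..1} \<Longrightarrow> \<sigma> t \<in> {0..\<sigma> 1}"
    using reparametrization_mono[OF assms, of 0 t] reparametrization_mono[OF assms, of t 1] * by auto
qed

text \<open>The second derivative is the product rule for the absolutely continuous \<open>r\<close>
  and the C^1 function \<open>X' (\<sigma> t)\<close>. It is square integrable because
  \<open>\<rho>\<close> is and all other factors are bounded on [0,1].\<close>

lemma W22_rep_compose:
  assumes rep: "reparametrization \<sigma> r \<rho>"
    and X: "\<And>s. (X has_vector_derivative X' s) (at s)"
    and X': "\<And>s. (X' has_vector_derivative X'' s) (at s)"
    and X'': "continuous_on UNIV X''"
  shows "W22_rep (\<lambda>t. X (\<sigma> t)) (\<lambda>t. r t *\<^sub>R X' (\<sigma> t))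
     (\<lambda>t. \<rho> t *\<^sub>R X' (\<sigma> t) + r t *\<^sub>R (r t *\<^sub>R X'' (\<sigma> t)))"
proof -
  let ?v = "\<lambda>t. \<rho> t *\<^sub>R X' (\<sigma> t) + r t *\<^sub>R (r t *\<^sub>R X'' (\<sigma> t))"
  note r = reparametrization_continuous[OF rep]
  note d\<sigma> = reparametrization_derivative[OF rep]
  have c\<sigma>: "continuous_on {0..1} \<sigma>"
    by (rule continuous_on_vector_derivative[OF d\<sigma>])
  have chain: "((\<lambda>t. Y (\<sigma> t)) has_vector_derivative r t *\<^sub>R Y' (\<sigma> t)) (at t within {0..1})"
    if "\<And>s. (Y has_vector_derivative Y' s) (at s)" "t \<in> {0..1}" for Y Y' :: "real \<Rightarrow> real \<times> real" and t
    using vector_diff_chain_within[OF d\<sigma>[OF that(2)] has_vector_derivative_at_within[OF that(1)]]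
    by (simp add: o_def)
  have cX': "continuous_on UNIV X'"
    by (rule continuous_on_vector_derivative[OF has_vector_derivative_at_within[OF X']])
  have cc: "continuous_on {0..1} (\<lambda>t. X' (\<sigma> t))" "continuous_on {0..1} (\<lambda>t. X'' (\<sigma> t))"
    by (auto intro: continuous_on_compose2[OF cX' c\<sigma>] continuous_on_compose2[OF X'' c\<sigma>])
  have w': "continuous_on {0..1} (\<lambda>t. r t *\<^sub>R X'' (\<sigma> t))"
    by (intro continuous_intros r cc)
  have \<rho>: "\<rho> absolutely_integrable_on {0..1}" "\<And>t. t \<in> {0..1} \<Longrightarrow> r t = r 0 + integral {0..t} \<rho>"
    using reparametrizationD[OF rep] by blast+
  note P = indefinite_integral_product[OF bounded_bilinear_scaleR \<rho> chain[OF X'] w']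
  show ?thesis
    unfolding W22_rep_def
  proof (intro conjI ballI)
    show v: "?v absolutely_integrable_on {0..1}" by (rule P(1))
    show "r t *\<^sub>R X' (\<sigma> t) = r 0 *\<^sub>R X' (\<sigma> 0) + integral {0..t} ?v" if "t \<in> {0..1}" for t
      by (rule P(2)[OF _ _ that])
    show "X (\<sigma> t) = X (\<sigma> 0) + integral {0..t} (\<lambda>t. r t *\<^sub>R X' (\<sigma> t))" if t: "t \<in> {0..1}" for t
    proof -
      have "((\<lambda>t. r t *\<^sub>R X' (\<sigma> t)) has_integral (X (\<sigma> t) - X (\<sigma> 0))) {0..t}"
        by (rule fundamental_theorem_of_calculus)
          (use t in \<open>auto intro!: has_vector_derivative_within_subset[OF chain[OF X]]\<close>)
      then show ?thesis by (simp add: integral_unique)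
    qed
    have "bounded ((\<lambda>t. X' (\<sigma> t)) ` {0..1})" "bounded ((\<lambda>t. r t *\<^sub>R (r t *\<^sub>R X'' (\<sigma> t))) ` {0..1})"
      by (auto intro!: compact_imp_bounded compact_continuous_image continuous_intros r cc)
    then obtain A B where A: "\<And>t. t \<in> {0..1} \<Longrightarrow> norm (X' (\<sigma> t)) \<le> A"
      and B: "\<And>t. t \<in> {0..1} \<Longrightarrow> norm (r t *\<^sub>R (r t *\<^sub>R X'' (\<sigma> t))) \<le> B"
      unfolding bounded_iff by fast
    show "(\<lambda>t. (norm (?v t))\<^sup>2) integrable_on {0..1}"
    proof (rule measurable_bounded_by_integrable_imp_integrable_real)
      have "?v \<in> borel_measurable (lebesgue_on {0..1})"
        by (rule absolutely_integrable_imp_borel_measurable[OF v]) simp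
      then show "(\<lambda>t. (norm (?v t))\<^sup>2) \<in> borel_measurable (lebesgue_on {0..1})"
        by (rule measurable_compose[OF _ borel_measurable_continuous_onI[of "\<lambda>x. (norm x)\<^sup>2"]])
          (intro continuous_intros)
      show "(\<lambda>t. 2 * A\<^sup>2 * (\<rho> t)\<^sup>2 + 2 * B\<^sup>2) integrable_on {0..1}"
        by (intro integrable_add integrable_on_mult_right reparametrizationD(2)[OF rep] integrable_const_ivl)
      fix t :: real assume t: "t \<in> {0..1}"
      have "\<bar>\<rho> t\<bar> * norm (X' (\<sigma> t)) \<le> \<bar>\<rho> t\<bar> * A"
        by (rule mult_left_mono[OF A[OF t]]) simp
      then have "norm (?v t) \<le> \<bar>\<rho> t\<bar> * A + B"
        using norm_triangle_ineq[of "\<rho> t *\<^sub>R X' (\<sigma> t)" "r t *\<^sub>R (r t *\<^sub>R X'' (\<sigma> t))"] B[OF t]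
        unfolding norm_scaleR[of "\<rho> t"] by linarith
      then have "(norm (?v t))\<^sup>2 \<le> (\<bar>\<rho> t\<bar> * A + B)\<^sup>2" by (rule power_mono) simp
      also have "\<dots> \<le> 2 * (\<bar>\<rho> t\<bar> * A)\<^sup>2 + 2 * B\<^sup>2"
        using sum_squares_ge_zero[of "\<bar>\<rho> t\<bar> * A - B" 0] by (simp add: power2_eq_square algebra_simps)
      finally show "\<bar>(norm (?v t))\<^sup>2\<bar> \<le> 2 * A\<^sup>2 * (\<rho> t)\<^sup>2 + 2 * B\<^sup>2"
        by (simp add: power_mult_distrib algebra_simps)
    qed simp
  qed
qed

text \<open>Here \<open>a\<close> and \<open>b\<close> are the first and second derivatives of a
  curve; the exponent 5 is the exponent 6 of the squared curvature lowered by the length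
  element.\<close>

definition energy_density :: "real \<Rightarrow> real \<times> real \<Rightarrow> real \<times> real \<Rightarrow> real" where
  "energy_density lam a b = (cross2 a b)^2 / (norm a)^5 + lam * norm a"

text \<open>The term with \<open>\<rho>\<close> is parallel to \<open>X'\<close> and drops out of
  \<open>cross2\<close>, which leaves a factor \<open>r^3\<close>. Squared and divided by
  \<open>r^5\<close>, it becomes the single \<open>r\<close> that the substitution
  \<open>s = \<sigma> t\<close> requires.\<close>

lemma energy_compose:
  assumes rep: "reparametrization \<sigma> r \<rho>"
    and X: "\<And>s. (X has_vector_derivative X' s) (at s)"
    and X': "\<And>s. (X' has_vector_derivative X'' s) (at s)"
    and X'': "continuous_on UNIV X''"
    and nz: "\<And>s. s \<in> {0..\<sigma> 1} \<Longrightarrow> X' s \<noteq> 0"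
    and \<gamma>: "\<And>t. t \<in> {0..1} \<Longrightarrow> \<gamma> t = X (\<sigma> t)"
  shows "energy lam \<gamma> = integral {0..\<sigma> 1} (\<lambda>s. energy_density lam (X' s) (X'' s))"
proof -
  have W: "W22_rep \<gamma> (\<lambda>t. r t *\<^sub>R X' (\<sigma> t)) (\<lambda>t. \<rho> t *\<^sub>R X' (\<sigma> t) + r t *\<^sub>R (r t *\<^sub>R X'' (\<sigma> t)))"
    by (rule W22_rep_cong[OF W22_rep_compose[OF rep X X' X''] \<gamma>])
  note rng = reparametrization_range[OF rep]
  let ?f = "\<lambda>s. (cross2 (X' s) (X'' s))^2 / (norm (X' s))^5"
  let ?g = "\<lambda>s. norm (X' s)"
  have cX': "continuous_on UNIV X'"
    by (rule continuous_on_vector_derivative[OF has_vector_derivative_at_within[OF X']])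
  have g: "continuous_on {0..\<sigma> 1} ?g"
    by (intro continuous_intros continuous_on_subset[OF cX']) simp
  have f: "continuous_on {0..\<sigma> 1} ?f"
    unfolding cross2_def
    by (intro continuous_intros continuous_on_subset[OF cX'] continuous_on_subset[OF X'']) (use nz in auto)
  have sub: "((\<lambda>t. r t *\<^sub>R h (\<sigma> t)) has_integral integral {0..\<sigma> 1} h) {0..1}"
    if "continuous_on {0..\<sigma> 1} h" for h :: "real \<Rightarrow> real"
    using has_integral_substitution[of 0 1 \<sigma> 0 "\<sigma> 1" h r] that rng reparametrization_derivative[OF rep]
    by (simp add: has_real_derivative_iff_has_vector_derivative image_subset_iff)
  have r: "t \<in> {0..1} \<Longrightarrow> r t > 0" for t by (rule reparametrizationD(5)[OF rep])
  have "integral {0..1} (\<lambda>t. (cross2 (r t *\<^sub>R X' (\<sigma> t)) (\<rho> t *\<^sub>R X' (\<sigma> t) + r t *\<^sub>R r t *\<^sub>R X'' (\<sigma> t)))\<^sup>2 /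
         norm (r t *\<^sub>R X' (\<sigma> t)) ^ 6 * norm (r t *\<^sub>R X' (\<sigma> t))) = integral {0..1} (\<lambda>t. r t *\<^sub>R ?f (\<sigma> t))"
  proof (rule integral_cong)
    fix t :: real assume t: "t \<in> {0..1}"
    have nz': "norm (X' (\<sigma> t)) \<noteq> 0" using nz rng(2)[OF t] by auto
    have "cross2 (r t *\<^sub>R X' (\<sigma> t)) (\<rho> t *\<^sub>R X' (\<sigma> t) + r t *\<^sub>R r t *\<^sub>R X'' (\<sigma> t))
      = (r t)^3 * cross2 (X' (\<sigma> t)) (X'' (\<sigma> t))"
      by (simp add: cross2_def power3_eq_cube algebra_simps)
    then show "(cross2 (r t *\<^sub>R X' (\<sigma> t)) (\<rho> t *\<^sub>R X' (\<sigma> t) + r t *\<^sub>R r t *\<^sub>R X'' (\<sigma> t)))\<^sup>2 /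
         norm (r t *\<^sub>R X' (\<sigma> t)) ^ 6 * norm (r t *\<^sub>R X' (\<sigma> t)) = r t *\<^sub>R ?f (\<sigma> t)"
      using r[OF t] nz' by (simp add: power_mult_distrib field_simps power_numeral_reduce)
  qed
  also have "\<dots> = integral {0..\<sigma> 1} ?f" using sub[OF f] by (rule integral_unique)
  finally have 1: "bending \<gamma> = integral {0..\<sigma> 1} ?f"
    unfolding W22_rep_bending[OF W] .
  have "curve_length \<gamma> = integral {0..1} (\<lambda>t. r t *\<^sub>R ?g (\<sigma> t))"
    unfolding W22_rep_length[OF W] by (rule integral_cong) (use r in \<open>auto simp: less_imp_le\<close>)
  also have "\<dots> = integral {0..\<sigma> 1} ?g" using sub[OF g] by (rule integral_unique)
  finally have 2: "curve_length \<gamma> = integral {0..\<sigma> 1} ?g" .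
  have "integral {0..\<sigma> 1} (\<lambda>s. ?f s + lam * ?g s) = integral {0..\<sigma> 1} ?f + integral {0..\<sigma> 1} (\<lambda>s. lam * ?g s)"
    by (intro integral_add integrable_continuous_real f continuous_intros g)
  then show ?thesis
    unfolding energy_def 1 2 energy_density_def by simp
qed

text \<open>\<open>B\<close> depends on the change of parameter only and is fixed before the curve
  and the bound, so uniform C^2 smallness in \<open>s\<close> gives W^{2,2} smallness in
  \<open>t\<close>.\<close>

lemma W22_norm_compose_le:
  assumes rep: "reparametrization \<sigma> r \<rho>"
  obtains B where "B > 0"
    "\<And>X X' X'' \<kappa> \<gamma>. \<lbrakk>\<And>s. (X has_vector_derivative X' s) (at s); \<And>s. (X' has_vector_derivative X'' s) (at s);
        continuous_on UNIV X'';
        \<And>s. s \<in> {0..\<sigma> 1} \<Longrightarrow> norm (X s) \<le> \<kappa> \<and> norm (X' s) \<le> \<kappa> \<and> norm (X'' s) \<le> \<kappa>;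
        \<And>t. t \<in> {0..1} \<Longrightarrow> \<gamma> t = X (\<sigma> t)\<rbrakk> \<Longrightarrow> W22_norm \<gamma> \<le> \<kappa> * B"
proof -
  let ?b = "\<lambda>t. 1 + (r t)\<^sup>2 + (2 * (\<rho> t)\<^sup>2 + 2 * (r t ^ 4))"
  note rng = reparametrization_range[OF rep]
  have bi: "?b integrable_on {0..1}"
    by (intro integrable_add integrable_on_mult_right reparametrizationD(2)[OF rep] integrable_continuous_real
        continuous_intros reparametrization_continuous[OF rep])
  define I where "I = integral {0..1} ?b"
  have "0 \<le> I" unfolding I_def
    by (rule integral_nonneg[OF bi]) (auto intro!: add_nonneg_nonneg)
  show ?thesis
  \<comment> \<open>Adding 1 makes the constant positive without a positive lower bound for
    \<open>I\<close>.\<close>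
  proof (rule that[of "sqrt I + 1"])
    show "0 < sqrt I + 1" using \<open>0 \<le> I\<close> by (simp add: add_nonneg_pos)
    fix X X' X'' :: "real \<Rightarrow> real \<times> real" and \<kappa> :: real and \<gamma>
    assume X: "\<And>s. (X has_vector_derivative X' s) (at s)" "\<And>s. (X' has_vector_derivative X'' s) (at s)"
      "continuous_on UNIV X''"
      and \<kappa>: "\<And>s. s \<in> {0..\<sigma> 1} \<Longrightarrow> norm (X s) \<le> \<kappa> \<and> norm (X' s) \<le> \<kappa> \<and> norm (X'' s) \<le> \<kappa>"
      and \<gamma>: "\<And>t. t \<in> {0..1} \<Longrightarrow> \<gamma> t = X (\<sigma> t)"
    have W: "W22_rep \<gamma> (\<lambda>t. r t *\<^sub>R X' (\<sigma> t)) (\<lambda>t. \<rho> t *\<^sub>R X' (\<sigma> t) + r t *\<^sub>R (r t *\<^sub>R X'' (\<sigma> t)))"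
    by (rule W22_rep_cong[OF W22_rep_compose[OF rep X] \<gamma>])
    have k0: "0 \<le> \<kappa>" using \<kappa>[of "\<sigma> 0"] rng(2)[of 0] norm_ge_zero order_trans by (metis atLeastAtMost_iff order_refl zero_le_one)
    let ?u = "\<lambda>t. r t *\<^sub>R X' (\<sigma> t)"
    let ?v = "\<lambda>t. \<rho> t *\<^sub>R X' (\<sigma> t) + r t *\<^sub>R (r t *\<^sub>R X'' (\<sigma> t))"
    have le: "(norm (\<gamma> t))\<^sup>2 + (norm (?u t))\<^sup>2 + (norm (?v t))\<^sup>2 \<le> \<kappa>\<^sup>2 * ?b t" if t: "t \<in> {0..1}" for t
    proof -
      note k = \<kappa>[OF rng(2)[OF t]]
      have "(norm (\<gamma> t))\<^sup>2 \<le> \<kappa>\<^sup>2" using k \<gamma>[OF t] by (intro power_mono) auto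
      moreover have "(norm (?u t))\<^sup>2 \<le> (\<bar>r t\<bar> * \<kappa>)\<^sup>2" using k by (intro power_mono) (auto intro: mult_left_mono)
      moreover have "(norm (?v t))\<^sup>2 \<le> 2 * (\<bar>\<rho> t\<bar> * \<kappa>)\<^sup>2 + 2 * (\<bar>r t\<bar> * (\<bar>r t\<bar> * \<kappa>))\<^sup>2"
      proof -
        have "norm (?v t) \<le> \<bar>\<rho> t\<bar> * \<kappa> + \<bar>r t\<bar> * (\<bar>r t\<bar> * \<kappa>)"
          by (rule order_trans[OF norm_triangle_ineq], unfold norm_scaleR, intro add_mono mult_left_mono) (use k in auto)
        then have "(norm (?v t))\<^sup>2 \<le> (\<bar>\<rho> t\<bar> * \<kappa> + \<bar>r t\<bar> * (\<bar>r t\<bar> * \<kappa>))\<^sup>2" by (rule power_mono) simp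
        also have "\<dots> \<le> 2 * (\<bar>\<rho> t\<bar> * \<kappa>)\<^sup>2 + 2 * (\<bar>r t\<bar> * (\<bar>r t\<bar> * \<kappa>))\<^sup>2"
          using sum_squares_ge_zero[of "\<bar>\<rho> t\<bar> * \<kappa> - \<bar>r t\<bar> * (\<bar>r t\<bar> * \<kappa>)" 0]
          by (simp add: power2_eq_square algebra_simps)
        finally show ?thesis .
      qed
      ultimately have "(norm (\<gamma> t))\<^sup>2 + (norm (?u t))\<^sup>2 + (norm (?v t))\<^sup>2 \<le>
         \<kappa>\<^sup>2 + (\<bar>r t\<bar> * \<kappa>)\<^sup>2 + (2 * (\<bar>\<rho> t\<bar> * \<kappa>)\<^sup>2 + 2 * (\<bar>r t\<bar> * (\<bar>r t\<bar> * \<kappa>))\<^sup>2)" by linarith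
      also have "\<dots> = \<kappa>\<^sup>2 * ?b t"
        by (simp add: power_mult_distrib algebra_simps power_numeral_reduce)
      finally show ?thesis .
    qed
    have v2: "(\<lambda>t. (norm (?v t))\<^sup>2) integrable_on {0..1}" by (rule W22_repD(2)[OF W])
    have c\<gamma>: "continuous_on {0..1} \<gamma>"
      by (rule continuous_on_vector_derivative[OF W22_rep_derivative[OF W]])
    have "integral {0..1} (\<lambda>t. (norm (\<gamma> t))\<^sup>2 + (norm (?u t))\<^sup>2 + (norm (?v t))\<^sup>2) \<le> integral {0..1} (\<lambda>t. \<kappa>\<^sup>2 * ?b t)"
    proof (rule integral_le[OF _ _ le])
      show "(\<lambda>t. (norm (\<gamma> t))\<^sup>2 + (norm (?u t))\<^sup>2 + (norm (?v t))\<^sup>2) integrable_on {0..1}"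
        by (intro integrable_add v2 integrable_continuous_real continuous_on_power continuous_on_norm c\<gamma> W22_rep_continuous[OF W])
      show "(\<lambda>t. \<kappa>\<^sup>2 * ?b t) integrable_on {0..1}"
        by (rule integrable_on_mult_right[OF bi])
    qed
    also have "\<dots> = \<kappa>\<^sup>2 * I" unfolding I_def by simp
    finally have "W22_norm \<gamma> \<le> sqrt (\<kappa>\<^sup>2 * I)" unfolding W22_rep_norm[OF W] by (rule real_sqrt_le_mono)
    also have "\<dots> = \<kappa> * sqrt I" using k0 by (simp add: real_sqrt_mult)
    also have "\<dots> \<le> \<kappa> * (sqrt I + 1)" using k0 by (intro mult_left_mono) auto
    finally show "W22_norm \<gamma> \<le> \<kappa> * (sqrt I + 1)" .
  qed
qed

section \<open>Shifting a periodic elastica\<close>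

text \<open>Differentiating a norm is avoided: the derivative of \<open>\<gamma>\<close> is
  \<open>r\<close> times the unit vector \<open>T\<close> at arclength, so the speed is the inner
  product of the two, and the product rule applies. Orthogonality of \<open>T\<close> and
  \<open>T'\<close> removes one term of the result, and what remains is bounded by the norm of
  \<open>v\<close>, hence square integrable.\<close>

lemma arclength_reparametrization:
  assumes \<gamma>: "\<gamma> \<in> A_ell ell" and c\<gamma>: "\<And>t. t \<in> {0..1} \<Longrightarrow> \<gamma> t = c (arclen \<gamma> t)"
    and c: "\<And>s. (c has_vector_derivative T s) (at s)"
    and T: "\<And>s. (T has_vector_derivative T' s) (at s)"
    and T': "continuous_on UNIV T'"
    and nT: "\<And>s. norm (T s) = 1" and TT': "\<And>s. T s \<bullet> T' s = 0"
  obtains r \<rho> where "reparametrization (arclen \<gamma>) r \<rho>"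
proof -
  let ?\<sigma> = "arclen \<gamma>"
  obtain u v where W: "W22_rep \<gamma> u v" using \<gamma> unfolding A_ell_def W22_iff_rep by blast
  define r where "r = (\<lambda>t. norm (d1 \<gamma> t))"
  have ru: "r t = norm (u t)" if "t \<in> {0..1}" for t
    unfolding r_def W22_rep_d1[OF W that] ..
  have cr: "continuous_on {0..1} r"
    by (rule continuous_on_eq[OF continuous_on_norm[OF W22_rep_continuous[OF W]]]) (simp add: ru)
  have \<sigma>: "?\<sigma> t = integral {0..t} r" for t
    by (simp add: arclen_def r_def)
  have d\<sigma>: "(?\<sigma> has_vector_derivative r t) (at t within {0..1})" if "t \<in> {0..1}" for t
    unfolding \<sigma> by (rule integral_has_vector_derivative[OF cr that])
  have chain: "((\<lambda>t. Y (?\<sigma> t)) has_vector_derivative r t *\<^sub>R Y' (?\<sigma> t)) (at t within {0..1})"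
    if "\<And>s. (Y has_vector_derivative Y' s) (at s)" "t \<in> {0..1}" for Y Y' :: "real \<Rightarrow> real \<times> real" and t
    using vector_diff_chain_within[OF d\<sigma>[OF that(2)] has_vector_derivative_at_within[OF that(1)]]
    by (simp add: o_def)
  have uT: "u t = r t *\<^sub>R T (?\<sigma> t)" if t: "t \<in> {0..1}" for t
  proof -
    have "(\<gamma> has_vector_derivative r t *\<^sub>R T (?\<sigma> t)) (at t within {0..1})"
      by (rule has_vector_derivative_transform[OF t c\<gamma> chain[OF c t]])
    then have "d1 \<gamma> t = r t *\<^sub>R T (?\<sigma> t)"
      unfolding d1_def by (intro vector_derivative_within_closed_interval) (use t in auto)
    then show ?thesis using W22_rep_d1[OF W t] by simp
  qed
  have "continuous_on {0..1} ?\<sigma>" by (rule continuous_on_vector_derivative[OF d\<sigma>])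
  then have w': "continuous_on {0..1} (\<lambda>t. r t *\<^sub>R T' (?\<sigma> t))"
    by (intro continuous_intros cr continuous_on_compose2[OF T']) auto
  let ?\<rho> = "\<lambda>s. v s \<bullet> T (?\<sigma> s) + u s \<bullet> (r s *\<^sub>R T' (?\<sigma> s))"
  note P = indefinite_integral_product[OF bounded_bilinear_inner W22_repD(1)[OF W] W22_repD(3)[OF W] chain[OF T] w']
  have nz: "d1 \<gamma> t \<noteq> 0" if "t \<in> {0..1}" for t using \<gamma> that by (simp add: A_ell_def)
  have TT: "T s \<bullet> T s = 1" for s using nT[of s] by (simp add: dot_square_norm)
  have rT: "r t = u t \<bullet> T (?\<sigma> t)" if "t \<in> {0..1}" for t using uT[OF that] by (simp add: TT)
  have "reparametrization ?\<sigma> r ?\<rho>"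
    unfolding reparametrization_def
  proof (intro conjI ballI)
    show \<rho>: "?\<rho> absolutely_integrable_on {0..1}" by (rule P(1))
    show "r t = r 0 + integral {0..t} ?\<rho>" if t: "t \<in> {0..1}" for t
      using P(2)[OF _ _ t] rT[OF t] rT[of 0] by simp
    show "0 < r t" if "t \<in> {0..1}" for t using nz[OF that] by (simp add: r_def)
    show "(\<lambda>t. (?\<rho> t)\<^sup>2) integrable_on {0..1}"
    proof (rule measurable_bounded_by_integrable_imp_integrable_real)
      have "?\<rho> \<in> borel_measurable (lebesgue_on {0..1})"
        by (rule absolutely_integrable_imp_borel_measurable[OF \<rho>]) simp
      then show "(\<lambda>t. (?\<rho> t)\<^sup>2) \<in> borel_measurable (lebesgue_on {0..1})"
        by (rule borel_measurable_power)
      show "(\<lambda>t. (norm (v t))\<^sup>2) integrable_on {0..1}" by (rule W22_repD(2)[OF W])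
      fix t :: real assume t: "t \<in> {0..1}"
      have eq: "?\<rho> t = v t \<bullet> T (?\<sigma> t)" using uT[OF t] TT' by simp
      have "\<bar>?\<rho> t\<bar> \<le> norm (v t)" unfolding eq using Cauchy_Schwarz_ineq2[of "v t" "T (?\<sigma> t)"] nT by simp
      then have "\<bar>?\<rho> t\<bar>\<^sup>2 \<le> (norm (v t))\<^sup>2" by (rule power_mono) simp
      then show "\<bar>(?\<rho> t)\<^sup>2\<bar> \<le> (norm (v t))\<^sup>2" by simp
    qed simp
  qed (use \<sigma> in simp)
  then show ?thesis using that by blast
qed

section \<open>First variation of the energy and the shift argument\<close>

definition energy_density_deriv :: "real \<Rightarrow> real \<times> real \<Rightarrow> real \<times> real \<Rightarrow> real \<times> real \<Rightarrow> real \<times> real \<Rightarrow> real" where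
  "energy_density_deriv lam a b a' b' =
     2 * cross2 a b * (cross2 a' b + cross2 a b') / (norm a)^5
     - 5 * (cross2 a b)^2 * (a \<bullet> a') / (norm a)^7 + lam * (a \<bullet> a') / norm a"

lemma energy_density_has_derivative:
  assumes "a + t *\<^sub>R a' \<noteq> 0"
  shows "((\<lambda>t. energy_density lam (a + t *\<^sub>R a') (b + t *\<^sub>R b')) has_real_derivative
     energy_density_deriv lam (a + t *\<^sub>R a') (b + t *\<^sub>R b') a' b') (at t)"
proof -
  have n: "((\<lambda>t. norm (a + t *\<^sub>R a')) has_real_derivative (a + t *\<^sub>R a') \<bullet> a' / norm (a + t *\<^sub>R a')) (at t)"
  proof -
    have *: "((\<lambda>t. (a + t *\<^sub>R a') \<bullet> (a + t *\<^sub>R a')) has_real_derivative 2 * ((a + t *\<^sub>R a') \<bullet> a')) (at t)"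
      unfolding has_field_derivative_def
      by (auto intro!: derivative_eq_intros simp: inner_commute algebra_simps)
    have "((\<lambda>t. sqrt ((a + t *\<^sub>R a') \<bullet> (a + t *\<^sub>R a'))) has_real_derivative
        2 * ((a + t *\<^sub>R a') \<bullet> a') * (inverse (sqrt ((a + t *\<^sub>R a') \<bullet> (a + t *\<^sub>R a'))) / 2)) (at t)"
      using DERIV_chain2[OF DERIV_real_sqrt *] assms by (simp add: mult.commute)
    then show ?thesis unfolding norm_eq_sqrt_inner[symmetric] by (simp add: field_simps)
  qed
  have x: "((\<lambda>t. cross2 (a + t *\<^sub>R a') (b + t *\<^sub>R b')) has_real_derivative
     cross2 a' (b + t *\<^sub>R b') + cross2 (a + t *\<^sub>R a') b') (at t)"
    unfolding cross2_def by (auto intro!: derivative_eq_intros simp: algebra_simps)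
  let ?n = "norm (a + t *\<^sub>R a')" and ?x = "cross2 (a + t *\<^sub>R a') (b + t *\<^sub>R b')"
  have nz: "?n \<noteq> 0" using assms by simp
  show ?thesis
    unfolding energy_density_def energy_density_deriv_def
    by (rule derivative_eq_intros n x refl | (use nz in \<open>simp; fail\<close>))+
      (use nz in \<open>simp add: field_simps power_numeral_reduce\<close>)
qed

lemma continuous_on_energy_density_deriv:
  assumes "continuous_on S a" "continuous_on S b" "continuous_on S a'" "continuous_on S b'"
    and "\<And>x. x \<in> S \<Longrightarrow> a x \<noteq> 0"
  shows "continuous_on S (\<lambda>x. energy_density_deriv lam (a x) (b x) (a' x) (b' x))"
  unfolding energy_density_deriv_def cross2_def
  by (intro continuous_intros assms) (use assms(5) in auto)

lemma continuous_on_energy_density: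
  assumes "continuous_on S a" "continuous_on S b" "\<And>x. x \<in> S \<Longrightarrow> a x \<noteq> 0"
  shows "continuous_on S (\<lambda>x. energy_density lam (a x) (b x))"
  unfolding energy_density_def cross2_def
  by (intro continuous_intros assms) (use assms(3) in auto)

text \<open>\<open>p\<close> and \<open>p2\<close> stand for the first two derivatives of the base
  curve, \<open>w\<close> and \<open>w2\<close> for those of the variation. Differentiation under
  the integral is legitimate since the perturbed tangent does not vanish on the compact rectangle of
  all \<open>t\<close> up to \<open>d\<close> and all \<open>s\<close>.\<close>

lemma energy_first_variation:
  fixes L :: real
  assumes p: "continuous_on {0..L} p" and p2: "continuous_on {0..L} p2"
    and w: "continuous_on {0..L} w" and w2: "continuous_on {0..L} w2"
    and d: "d > 0" and nz: "\<And>t s. \<bar>t\<bar> \<le> d \<Longrightarrow> s \<in> {0..L} \<Longrightarrow> p s + t *\<^sub>R w s \<noteq> 0"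
  shows "((\<lambda>t. integral {0..L} (\<lambda>s. energy_density lam (p s + t *\<^sub>R w s) (p2 s + t *\<^sub>R w2 s)))
     has_real_derivative integral {0..L} (\<lambda>s. energy_density_deriv lam (p s) (p2 s) (w s) (w2 s))) (at 0)"
proof -
  let ?U = "{-d..d}"
  have c2: "continuous_on (?U \<times> {0..L}) (\<lambda>x. f (snd x))" if "continuous_on {0..L} f" for f :: "real \<Rightarrow> real \<times> real"
    by (rule continuous_on_compose2[OF that continuous_on_snd[OF continuous_on_id]]) auto
  have "((\<lambda>t. integral (cbox 0 L) (\<lambda>s. energy_density lam (p s + t *\<^sub>R w s) (p2 s + t *\<^sub>R w2 s)))
     has_real_derivative integral (cbox 0 L) (\<lambda>s. energy_density_deriv lam (p s + 0 *\<^sub>R w s) (p2 s + 0 *\<^sub>R w2 s) (w s) (w2 s))) (at 0 within ?U)"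
  proof (rule leibniz_rule_field_derivative)
    fix t s assume "t \<in> ?U" "s \<in> cbox 0 L"
    then have "p s + t *\<^sub>R w s \<noteq> 0" using nz[of t s] by (auto simp: abs_le_iff)
    then show "((\<lambda>t. energy_density lam (p s + t *\<^sub>R w s) (p2 s + t *\<^sub>R w2 s)) has_real_derivative
        energy_density_deriv lam (p s + t *\<^sub>R w s) (p2 s + t *\<^sub>R w2 s) (w s) (w2 s)) (at t within ?U)"
      by (rule has_field_derivative_at_within[OF energy_density_has_derivative])
  next
    fix t assume "t \<in> ?U"
    then have "\<bar>t\<bar> \<le> d" by auto
    then show "(\<lambda>s. energy_density lam (p s + t *\<^sub>R w s) (p2 s + t *\<^sub>R w2 s)) integrable_on cbox 0 L"
      unfolding cbox_interval
      by (intro integrable_continuous_real continuous_on_energy_density continuous_intros p p2 w w2 nz)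
  next
    show "continuous_on (?U \<times> cbox 0 L)
     (\<lambda>(t, s). energy_density_deriv lam (p s + t *\<^sub>R w s) (p2 s + t *\<^sub>R w2 s) (w s) (w2 s))"
      unfolding cbox_interval case_prod_beta
      by (intro continuous_on_energy_density_deriv continuous_intros c2 p p2 w w2)
        (use nz in \<open>auto simp: abs_le_iff\<close>)
  qed (use d in auto)
  moreover have "at 0 within ?U = at 0"
    by (rule at_within_interior) (use d in auto)
  ultimately show ?thesis by simp
qed

lemma integral_periodic_shift:
  fixes h :: "real \<Rightarrow> real"
  assumes "continuous_on UNIV h" "\<And>s. h (s + L) = h s" "0 \<le> e" "e \<le> L"
  shows "integral {0..L} (\<lambda>s. h (s + e)) = integral {0..L} h"
proof -
  have i: "h integrable_on {a..b}" for a b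
    by (intro integrable_continuous_real continuous_on_subset[OF assms(1)]) simp
  have sh: "integral {a..b::real} (\<lambda>s. h (s + z)) = integral {a+z..b+z} h" for a b z
    using integral_shift_Icc_real[of a b h z] by (simp add: o_def add.commute)
  have "integral {0..L} (\<lambda>s. h (s + e)) = integral {e..L+e} h" using sh[of 0 L e] by simp
  also have "\<dots> = integral {e..L} h + integral {L..L+e} h"
    by (rule Henstock_Kurzweil_Integration.integral_combine[symmetric]) (use assms i in auto)
  also have "integral {L..L+e} h = integral {0..e} h"
    using sh[of 0 e L] assms(2) by (simp add: add.commute)
  also have "integral {e..L} h + integral {0..e} h = integral {0..L} h"
    using Henstock_Kurzweil_Integration.integral_combine[of 0 e L h] assms i by simp
  finally show ?thesis .
qed

lemma has_vector_derivative_shift: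
  assumes "(f has_vector_derivative D) (at (s + e))"
  shows "((\<lambda>s::real. f (s + e)) has_vector_derivative D) (at s)"
proof -
  have "((\<lambda>s. s + e) has_vector_derivative 1) (at s)"
    by (auto intro!: derivative_eq_intros)
  from vector_diff_chain_at[OF this, of f D] assms show ?thesis by (simp add: o_def)
qed

text \<open>Free of elliptic functions, so that one argument serves arcs and loops: a Frenet frame,
  the conservation law with constant vector \<open>F\<close>, and periodicity of tangent and
  curvature. The curvature may vanish at 0 itself, hence the demand for points of nonzero curvature
  arbitrarily close to 0.\<close>

lemma periodic_elastica_not_local_minimizer:
  fixes c T N :: "real \<Rightarrow> real \<times> real" and k k' :: "real \<Rightarrow> real"
  assumes c: "\<And>s. (c has_vector_derivative T s) (at s)"
    and T: "\<And>s. (T has_vector_derivative k s *\<^sub>R N s) (at s)"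
    and N: "\<And>s. (N has_vector_derivative - k s *\<^sub>R T s) (at s)"
    and k: "\<And>s. (k has_real_derivative k' s) (at s)"
    and nT: "\<And>s. norm (T s) = 1"
    and NT: "\<And>s. N s = (- snd (T s), fst (T s))"
    and F: "\<And>s. (lam - (k s)^2) *\<^sub>R T s - (2 * k' s) *\<^sub>R N s = F"
    and per: "\<And>s. T (s + L) = T s" "\<And>s. k (s + L) = k s" and L: "0 < L"
    and c0: "c 0 = (0, 0)" and cL: "c L = (ell, 0)"
    and knz: "\<And>d. d > 0 \<Longrightarrow> \<exists>e. 0 < e \<and> e < d \<and> k e \<noteq> 0"
    and \<gamma>: "\<gamma> \<in> A_ell ell" and c\<gamma>: "\<And>t. t \<in> {0..1} \<Longrightarrow> \<gamma> t = c (arclen \<gamma> t)"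
    and len: "arclen \<gamma> 1 = L"
  shows "\<not> local_minimizer lam ell \<gamma>"
proof
  assume "local_minimizer lam ell \<gamma>"
  then obtain \<delta> where \<delta>: "\<delta> > 0"
    and min: "\<And>\<gamma>'. \<gamma>' \<in> A_ell ell \<Longrightarrow> W22_norm (\<lambda>t. \<gamma>' t - \<gamma> t) < \<delta> \<Longrightarrow> energy lam \<gamma> \<le> energy lam \<gamma>'"
    unfolding local_minimizer_def by blast
  have cont: "continuous_on UNIV c" "continuous_on UNIV T" "continuous_on UNIV N" "continuous_on UNIV k"
    using continuous_on_vector_derivative[OF has_vector_derivative_at_within[OF c]]
      continuous_on_vector_derivative[OF has_vector_derivative_at_within[OF T]]
      continuous_on_vector_derivative[OF has_vector_derivative_at_within[OF N]]
      DERIV_continuous_on[OF has_field_derivative_at_within[OF k]] by blast+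
  then have ckN: "continuous_on UNIV (\<lambda>s. k s *\<^sub>R N s)" by (intro continuous_intros)
  have TN: "T s \<bullet> N s = 0" "cross2 (T s) (N s) = 1" "norm (N s) = 1" for s
  proof -
    have "(fst (T s))\<^sup>2 + (snd (T s))\<^sup>2 = 1" using nT[of s] by (simp add: norm_prod_def)
    then show "T s \<bullet> N s = 0" "cross2 (T s) (N s) = 1" "norm (N s) = 1"
      by (auto simp: NT cross2_def inner_prod_def norm_prod_def power2_eq_square algebra_simps)
  qed
  obtain r \<rho> where rep: "reparametrization (arclen \<gamma>) r \<rho>"
    by (rule arclength_reparametrization[OF \<gamma> c\<gamma> c T ckN nT]) (use TN in auto)
  let ?\<sigma> = "arclen \<gamma>"
  note rng = reparametrization_range[OF rep, unfolded len]
  obtain B where B: "B > 0"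
    "\<And>X X' X'' \<kappa> \<gamma>. \<lbrakk>\<And>s. (X has_vector_derivative X' s) (at s); \<And>s. (X' has_vector_derivative X'' s) (at s);
        continuous_on UNIV X'';
        \<And>s. s \<in> {0..L} \<Longrightarrow> norm (X s) \<le> \<kappa> \<and> norm (X' s) \<le> \<kappa> \<and> norm (X'' s) \<le> \<kappa>;
        \<And>t. t \<in> {0..1} \<Longrightarrow> \<gamma> t = X (?\<sigma> t)\<rbrakk> \<Longrightarrow> W22_norm \<gamma> \<le> \<kappa> * B"
    using W22_norm_compose_le[OF rep, unfolded len] by blast
  \<comment> \<open>\<open>B\<close> turns a C^2 bound \<open>\<kappa>\<close> into a W^{2,2} bound
    \<open>\<kappa> * B\<close>; the factor 2 makes this strictly less than
    \<open>\<delta>\<close>.\<close>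
  define \<kappa> where "\<kappa> = \<delta> / (2 * B)"
  have \<kappa>: "\<kappa> > 0" "\<kappa> * B < \<delta>" using \<delta> B(1) by (auto simp: \<kappa>_def)
  \<comment> \<open>Half of \<open>\<kappa>\<close> is reserved for the shift and half for the
    perturbation. A quarter is asked for here because the shifted position contributes two such
    terms: the displacement at \<open>s\<close> and the translation by \<open>c e\<close>.\<close>
  have unif: "\<exists>d>0. \<forall>s\<in>{0..L}. \<forall>e. 0 \<le> e \<and> e < d \<longrightarrow> norm (f (s + e) - f s) \<le> \<kappa> / 4"
    if "continuous_on UNIV f" for f :: "real \<Rightarrow> real \<times> real"
  proof -
    \<comment> \<open>\<open>s + e\<close> may leave \<open>{0..L}\<close>, hence the longer
      interval and the cap 1 on the shift.\<close>
    have "uniformly_continuous_on {0..L+1} f"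
      by (intro compact_uniformly_continuous continuous_on_subset[OF that]) auto
    then obtain d where d: "d > 0" "\<And>x x'. x \<in> {0..L+1} \<Longrightarrow> x' \<in> {0..L+1} \<Longrightarrow> dist x' x < d \<Longrightarrow> dist (f x') (f x) < \<kappa> / 4"
      unfolding uniformly_continuous_on_def using \<kappa>(1) by (metis zero_less_divide_iff zero_less_numeral)
    have "norm (f (s + e) - f s) \<le> \<kappa> / 4" if "s \<in> {0..L}" "0 \<le> e" "e < min d 1" for s e
      using d(2)[of s "s + e"] that by (auto simp: dist_norm intro: less_imp_le)
    then show ?thesis using d(1) by (intro exI[of _ "min d 1"]) auto
  qed
  obtain da where da0: "da > 0"
    and da: "\<And>s e. s \<in> {0..L} \<Longrightarrow> 0 \<le> e \<Longrightarrow> e < da \<Longrightarrow> norm (c (s + e) - c s) \<le> \<kappa> / 4"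
    using unif[OF cont(1)] by auto
  obtain db where db0: "db > 0"
    and db: "\<And>s e. s \<in> {0..L} \<Longrightarrow> 0 \<le> e \<Longrightarrow> e < db \<Longrightarrow> norm (T (s + e) - T s) \<le> \<kappa> / 4"
    using unif[OF cont(2)] by auto
  obtain dc where dc0: "dc > 0"
    and dc: "\<And>s e. s \<in> {0..L} \<Longrightarrow> 0 \<le> e \<Longrightarrow> e < dc \<Longrightarrow> norm (k (s + e) *\<^sub>R N (s + e) - k s *\<^sub>R N s) \<le> \<kappa> / 4"
    using unif[OF ckN] by auto
  obtain e where e: "0 < e" "e < da" "e < db" "e < dc" "e < L" "k e \<noteq> 0"
    using knz[of "min (min da db) (min dc L)"] da0 db0 dc0 L by auto
  \<comment> \<open>By periodicity this constant vector is the unit normal of the shifted curve at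
    both of its endpoints.\<close>
  define v where "v = N e"
  \<comment> \<open>The coefficient \<open>s * (s - L)\<close> vanishes at both ends, so the
    endpoints stay fixed, and its slopes there are \<open>- L\<close> and \<open>L\<close>. The
    opposite signs make the two boundary terms of the first variation add up instead of
    cancelling.\<close>
  define X where "X \<tau> s = c (s + e) - c e + \<tau> *\<^sub>R (s * (s - L)) *\<^sub>R v" for \<tau> s
  define X' where "X' \<tau> s = T (s + e) + \<tau> *\<^sub>R (2 * s - L) *\<^sub>R v" for \<tau> s
  define X'' where "X'' \<tau> s = k (s + e) *\<^sub>R N (s + e) + \<tau> *\<^sub>R (2 *\<^sub>R v)" for \<tau> s
  note shift = has_vector_derivative_shift
  have dX: "(X \<tau> has_vector_derivative X' \<tau> s) (at s)" for \<tau> s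
    unfolding X_def X'_def
    by (rule derivative_eq_intros shift[OF c] refl)+ (simp add: algebra_simps)
  have dX': "(X' \<tau> has_vector_derivative X'' \<tau> s) (at s)" for \<tau> s
    unfolding X'_def X''_def
    by (rule derivative_eq_intros shift[OF T] refl)+ (simp add: algebra_simps)
  have cX'': "continuous_on UNIV (X'' \<tau>)" for \<tau>
    unfolding X''_def by (intro continuous_intros continuous_on_compose2[OF cont(4)] continuous_on_compose2[OF cont(3)]) auto
  \<comment> \<open>A common bound for the coefficients \<open>s * (s - L)\<close>,
    \<open>2 * s - L\<close> and 2 of the variation and its two derivatives.\<close>
  define M where "M = L\<^sup>2 + L + 2"
  have M: "M > 0" using L by (simp add: M_def add_pos_pos)
  \<comment> \<open>The first entry keeps the perturbation below half of \<open>\<kappa>\<close>;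
    the second keeps its derivative below 1/2, so that it cannot cancel the unit tangent.\<close>
  define d where "d = min (\<kappa> / (2 * M)) (1 / (2 * M))"
  have d: "d > 0" using \<kappa> M by (simp add: d_def)
  have nv: "norm v = 1" by (simp add: v_def TN)
  have small: "norm (\<tau> *\<^sub>R x *\<^sub>R v) \<le> \<kappa> / 2 \<and> norm (\<tau> *\<^sub>R x *\<^sub>R v) \<le> 1 / 2"
    if "\<bar>\<tau>\<bar> \<le> d" "\<bar>x\<bar> \<le> M" for \<tau> x
  proof -
    have "norm (\<tau> *\<^sub>R x *\<^sub>R v) = \<bar>\<tau>\<bar> * \<bar>x\<bar>" by (simp add: nv abs_mult)
    also have "\<dots> \<le> d * M" using that d by (intro mult_mono) auto
    finally have "norm (\<tau> *\<^sub>R x *\<^sub>R v) \<le> d * M" .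
    moreover have "d * M \<le> \<kappa> / (2 * M) * M" "d * M \<le> 1 / (2 * M) * M"
      using M by (rule mult_right_mono[rotated, OF less_imp_le], simp add: d_def)+
    ultimately show ?thesis using M by auto
  qed
  have bnd: "\<bar>s * (s - L)\<bar> \<le> M" "\<bar>2 * s - L\<bar> \<le> M" "\<bar>2\<bar> \<le> M" if "s \<in> {0..L}" for s
  proof -
    have "\<bar>s * (s - L)\<bar> \<le> L * L" unfolding abs_mult using that by (intro mult_mono) auto
    then show "\<bar>s * (s - L)\<bar> \<le> M" using L by (simp add: M_def power2_eq_square)
    have "\<bar>2 * s - L\<bar> \<le> L" using that by auto
    moreover have L2: "0 \<le> L\<^sup>2" by simp
    ultimately show "\<bar>2 * s - L\<bar> \<le> M" unfolding M_def by linarith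
    show "\<bar>2\<bar> \<le> M" using L L2 unfolding M_def by simp
  qed
  have nz: "X' \<tau> s \<noteq> 0" if "\<bar>\<tau>\<bar> \<le> d" "s \<in> {0..L}" for \<tau> s
  proof
    assume "X' \<tau> s = 0"
    then have "T (s + e) = - (\<tau> *\<^sub>R (2 * s - L) *\<^sub>R v)" unfolding X'_def by (rule eq_neg_iff_add_eq_0[THEN iffD2])
    then have "norm (T (s + e)) = norm (\<tau> *\<^sub>R (2 * s - L) *\<^sub>R v)" by (simp only: norm_minus_cancel)
    then show False using nT small[OF that(1) bnd(2)[OF that(2)]] by simp
  qed
  have cper: "c (s + L) = c s + c L" for s
  proof -
    have "((\<lambda>s. c (s + L) - c s) has_vector_derivative T (s + L) - T s) (at s)" for s
      by (intro has_vector_derivative_diff has_vector_derivative_shift c)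
    then have "((\<lambda>s. c (s + L) - c s) has_derivative (\<lambda>h. 0)) (at s)" for s
      by (simp add: per has_vector_derivative_def)
    then obtain z where z: "\<And>s. c (s + L) - c s = z"
      using has_derivative_zero_constant[of UNIV "\<lambda>s. c (s + L) - c s"] by auto
    show ?thesis using z[of s] z[of 0] c0 by (simp add: algebra_simps zero_prod_def)
  qed
  define J where "J \<tau> = integral {0..L} (\<lambda>s. energy_density lam (X' \<tau> s) (X'' \<tau> s))" for \<tau>
  have ge: "energy lam \<gamma> \<le> J \<tau>" if \<tau>: "\<bar>\<tau>\<bar> \<le> d" for \<tau>
  proof -
    let ?\<gamma>' = "\<lambda>t. X \<tau> (?\<sigma> t)"
    note W = W22_rep_compose[OF rep dX dX' cX'', of \<tau>]
    have "?\<gamma>' \<in> A_ell ell"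
      unfolding A_ell_def
    proof (intro CollectI conjI ballI)
      show "W22 ?\<gamma>'" using W W22_iff_rep by blast
      show "d1 ?\<gamma>' t \<noteq> 0" if "t \<in> {0..1}" for t
        using W22_rep_d1[OF W that] nz[OF \<tau> rng(2)[OF that]] reparametrizationD(5)[OF rep that] by simp
      show "?\<gamma>' 0 = (0, 0)" by (simp add: rng X_def zero_prod_def)
      show "?\<gamma>' 1 = (ell, 0)" using cper[of e] cL by (simp add: len X_def add.commute)
    qed
    moreover have "W22_norm (\<lambda>t. ?\<gamma>' t - \<gamma> t) \<le> \<kappa> * B"
    proof (rule B(2))
      show "((\<lambda>s. X \<tau> s - c s) has_vector_derivative X' \<tau> s - T s) (at s)" for s
        by (intro has_vector_derivative_diff dX c)
      show "((\<lambda>s. X' \<tau> s - T s) has_vector_derivative X'' \<tau> s - k s *\<^sub>R N s) (at s)" for s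
        by (intro has_vector_derivative_diff dX' T)
      show "continuous_on UNIV (\<lambda>s. X'' \<tau> s - k s *\<^sub>R N s)"
        by (intro continuous_intros cX'' ckN)
      show "?\<gamma>' t - \<gamma> t = X \<tau> (?\<sigma> t) - c (?\<sigma> t)" if "t \<in> {0..1}" for t
        by (simp add: c\<gamma>[OF that])
      fix s assume s: "s \<in> {0..L}"
      have tri: "norm (x + y) \<le> \<kappa>" if "norm x \<le> \<kappa> / 2" "norm y \<le> \<kappa> / 2" for x y :: "real \<times> real"
        using norm_triangle_ineq[of x y] that by linarith
      have a: "norm (c (s + e) - c s - c e) \<le> \<kappa> / 2"
      proof -
        have "norm (c (s + e) - c s) \<le> \<kappa> / 4" by (rule da[OF s]) (use e in auto)
        moreover have "norm (c e) \<le> \<kappa> / 4" using da[of 0 e] e L c0 by (simp add: zero_prod_def[symmetric])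
        ultimately show ?thesis using norm_triangle_ineq4[of "c (s + e) - c s" "c e"] by linarith
      qed
      have b: "norm (T (s + e) - T s) \<le> \<kappa> / 2" using db[OF s, of e] e \<kappa>(1) by linarith
      have b2: "norm (k (s + e) *\<^sub>R N (s + e) - k s *\<^sub>R N s) \<le> \<kappa> / 2" using dc[OF s, of e] e \<kappa>(1) by linarith
      have "X \<tau> s - c s = (c (s + e) - c s - c e) + \<tau> *\<^sub>R (s * (s - L)) *\<^sub>R v"
        "X' \<tau> s - T s = (T (s + e) - T s) + \<tau> *\<^sub>R (2 * s - L) *\<^sub>R v"
        "X'' \<tau> s - k s *\<^sub>R N s = (k (s + e) *\<^sub>R N (s + e) - k s *\<^sub>R N s) + \<tau> *\<^sub>R (2 *\<^sub>R v)"
        unfolding X_def X'_def X''_def by (simp_all only: algebra_simps)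
      then show "norm (X \<tau> s - c s) \<le> \<kappa> \<and> norm (X' \<tau> s - T s) \<le> \<kappa> \<and> norm (X'' \<tau> s - k s *\<^sub>R N s) \<le> \<kappa>"
        using tri[OF a] tri[OF b] tri[OF b2] small[OF \<tau> bnd(1)[OF s]] small[OF \<tau> bnd(2)[OF s]] small[OF \<tau> bnd(3)[OF s]]
        by metis
    qed
    ultimately have "energy lam \<gamma> \<le> energy lam ?\<gamma>'" using min \<kappa>(2) by auto
    also have "\<dots> = J \<tau>"
      unfolding J_def by (subst energy_compose[OF rep dX dX' cX'']) (use nz[OF \<tau>] len in auto)
    finally show ?thesis .
  qed
  have dens: "energy_density lam (T s) (k s *\<^sub>R N s) = (k s)\<^sup>2 + lam" for s
    using TN(2)[of s] nT by (simp add: energy_density_def cross2_def algebra_simps flip: right_diff_distrib)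
  have Tnz: "T s \<noteq> 0" for s using nT[of s] by auto
  have "energy lam \<gamma> = integral {0..?\<sigma> 1} (\<lambda>s. energy_density lam (T s) (k s *\<^sub>R N s))"
    by (rule energy_compose[OF rep c T ckN Tnz c\<gamma>])
  then have "energy lam \<gamma> = integral {0..L} (\<lambda>s. (k s)\<^sup>2 + lam)"
    unfolding dens len .
  also have "\<dots> = integral {0..L} (\<lambda>s. (k (s + e))\<^sup>2 + lam)"
    by (rule integral_periodic_shift[of "\<lambda>s. (k s)\<^sup>2 + lam", symmetric])
      (use e in \<open>auto simp: per intro!: continuous_intros cont\<close>)
  also have "\<dots> = J 0"
    by (simp add: J_def X'_def X''_def dens)
  finally have E0: "energy lam \<gamma> = J 0" .
  have cs: "continuous_on S (\<lambda>s. T (s + e))" "continuous_on S (\<lambda>s. k (s + e) *\<^sub>R N (s + e))" for S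
    by (auto intro!: continuous_intros continuous_on_compose2[OF cont(2)] continuous_on_compose2[OF cont(3)] continuous_on_compose2[OF cont(4)])
  have D: "(J has_real_derivative integral {0..L} (\<lambda>s. energy_density_deriv lam (T (s + e)) (k (s + e) *\<^sub>R N (s + e))
      ((2 * s - L) *\<^sub>R v) (2 *\<^sub>R v))) (at 0)"
    unfolding J_def X'_def X''_def
    by (rule energy_first_variation[OF cs _ _ d]) (use nz in \<open>auto intro!: continuous_intros simp: X'_def\<close>)
  \<comment> \<open>The shifted curve has the energy of \<open>\<gamma>\<close>, and every
    \<open>J \<tau>\<close> with small \<open>\<tau>\<close> is at least that energy, so 0 is an
    interior minimum of \<open>J\<close>.\<close>
  have "integral {0..L} (\<lambda>s. energy_density_deriv lam (T (s + e)) (k (s + e) *\<^sub>R N (s + e)) ((2 * s - L) *\<^sub>R v) (2 *\<^sub>R v)) = 0"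
  proof (rule DERIV_local_min[OF D d])
    show "\<forall>y. \<bar>0 - y\<bar> < d \<longrightarrow> J 0 \<le> J y" using ge E0 by auto
  qed
  \<comment> \<open>By the conservation law, \<open>2 k N \<bullet> \<eta>' + F \<bullet> \<eta>\<close> is an antiderivative of the first variation density.\<close>
  moreover have "((\<lambda>s. energy_density_deriv lam (T (s + e)) (k (s + e) *\<^sub>R N (s + e)) ((2 * s - L) *\<^sub>R v) (2 *\<^sub>R v))
     has_integral (h L - h 0)) {0..L}"
    if h: "h = (\<lambda>s. 2 * k (s + e) * (2 * s - L) * (N (s + e) \<bullet> v) + s * (s - L) * (F \<bullet> v))" for h
  proof (rule fundamental_theorem_of_calculus)
    show "0 \<le> L" using L by simp
    fix s
    let ?T = "T (s + e)" and ?N = "N (s + e)" and ?k = "k (s + e)"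
    have dk: "((\<lambda>s. k (s + e)) has_real_derivative k' (s + e)) (at s)"
      using DERIV_shift[of k "k' (s + e)" s e] k by simp
    have dN: "((\<lambda>s. N (s + e) \<bullet> v) has_real_derivative - ?k * (?T \<bullet> v)) (at s)"
      using bounded_linear.has_vector_derivative[OF bounded_linear_inner_left[of v] shift[OF N]]
      by (simp add: has_real_derivative_iff_has_vector_derivative)
    have "(h has_real_derivative 2 * k' (s + e) * (2 * s - L) * (?N \<bullet> v) + 2 * ?k * 2 * (?N \<bullet> v)
       - 2 * ?k * (2 * s - L) * ?k * (?T \<bullet> v) + (2 * s - L) * (F \<bullet> v)) (at s)"
      unfolding h by (rule derivative_eq_intros dk dN refl)+ (simp add: algebra_simps)
    also have "2 * k' (s + e) * (2 * s - L) * (?N \<bullet> v) + 2 * ?k * 2 * (?N \<bullet> v)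
       - 2 * ?k * (2 * s - L) * ?k * (?T \<bullet> v) + (2 * s - L) * (F \<bullet> v)
      = energy_density_deriv lam ?T (?k *\<^sub>R ?N) ((2 * s - L) *\<^sub>R v) (2 *\<^sub>R v)"
    proof -
      have x1: "cross2 ?T (?k *\<^sub>R ?N) = ?k" using TN(2)[of "s + e"] by (simp add: cross2_def algebra_simps flip: right_diff_distrib)
      have x2: "cross2 v ?N = ?T \<bullet> v" "cross2 ?T v = ?N \<bullet> v"
        by (simp_all add: NT cross2_def inner_prod_def)
      have x3: "cross2 ((2 * s - L) *\<^sub>R v) (?k *\<^sub>R ?N) + cross2 ?T (2 *\<^sub>R v) = (2 * s - L) * ?k * (?T \<bullet> v) + 2 * (?N \<bullet> v)"
        unfolding x2[symmetric] by (simp add: cross2_def algebra_simps)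
      have F': "F \<bullet> v = (lam - ?k\<^sup>2) * (?T \<bullet> v) - 2 * k' (s + e) * (?N \<bullet> v)"
        unfolding F[of "s + e", symmetric] by (simp add: inner_diff_left)
      show ?thesis
        unfolding energy_density_deriv_def x1 x3 F' nT
        by (simp add: power2_eq_square algebra_simps)
    qed
    finally show "(h has_vector_derivative energy_density_deriv lam ?T (?k *\<^sub>R ?N) ((2 * s - L) *\<^sub>R v) (2 *\<^sub>R v)) (at s within {0..L})"
      unfolding has_real_derivative_iff_has_vector_derivative by (rule has_vector_derivative_at_within)
  qed
  \<comment> \<open>This is \<open>h L - h 0\<close>: the term with \<open>F\<close> vanishes at
    both ends, and \<open>2 * s - L\<close> is negative at 0, which accounts for the plus
    sign.\<close>
  ultimately have "2 * k (L + e) * L * (N (L + e) \<bullet> v) + 2 * k e * L * (N e \<bullet> v) = 0"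
    by (auto dest!: integral_unique)
  moreover have "N (L + e) = N e" "k (L + e) = k e"
    using per[of e] NT by (simp_all add: add.commute)
  moreover have "N e \<bullet> v = 1" using nv by (simp add: v_def dot_square_norm)
  ultimately show False using e(6) L by simp
qed

section \<open>Wavelike elasticae\<close>

lemma sint_has_real_derivative:
  assumes "continuous_on UNIV f"
  shows "(sint f has_real_derivative f x) (at x)"
proof -
  \<comment> \<open>The interval surrounds both 0 and \<open>x\<close>; on it the two branches of
    \<open>sint\<close> are one indefinite integral up to a constant.\<close>
  define a where "a = - \<bar>x\<bar> - 1"
  define b where "b = \<bar>x\<bar> + 1"
  have i: "f integrable_on {c..d}" for c d
    by (intro integrable_continuous_real continuous_on_subset[OF assms]) simp
  have xab: "x \<in> {a..b}" by (auto simp: a_def b_def)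
  have eq: "sint f y = integral {a..y} f - integral {a..0} f" if "y \<in> {a..b}" for y
  proof (cases "0 \<le> y")
    case True
    have "integral {a..0} f + integral {0..y} f = integral {a..y} f"
      by (rule Henstock_Kurzweil_Integration.integral_combine) (use True i in \<open>auto simp: a_def\<close>)
    then show ?thesis using True by (simp add: sint_def)
  next
    case False
    have "integral {a..y} f + integral {y..0} f = integral {a..0} f"
      by (rule Henstock_Kurzweil_Integration.integral_combine) (use False that i in auto)
    then show ?thesis using False by (simp add: sint_def)
  qed
  have "((\<lambda>y. integral {a..y} f - integral {a..0} f) has_real_derivative f x) (at x within {a..b})"
    using DERIV_diff[OF integral_has_real_derivative[OF continuous_on_subset[OF assms subset_UNIV] xab]
        DERIV_const[of "integral {a..0} f"]] by simp
  then have "(sint f has_real_derivative f x) (at x within {a..b})"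
    by (rule has_field_derivative_transform_within[OF _ zero_less_one]) (auto simp: eq a_def b_def)
  moreover have "at x within {a..b} = at x"
    by (rule at_within_interior) (auto simp: a_def b_def)
  ultimately show ?thesis by simp
qed

lemma sint_zero [simp]: "sint f 0 = 0"
  by (simp add: sint_def)

lemma sint_minus:
  assumes "continuous_on UNIV f" "\<And>x. f (- x) = f x"
  shows "sint f (- x) = - sint f x"
proof -
  have "((\<lambda>x. sint f x + sint f (- x)) has_real_derivative 0) (at x)" for x
    by (auto intro!: derivative_eq_intros DERIV_chain2[OF sint_has_real_derivative[OF assms(1)]] simp: assms(2))
  then have "sint f x + sint f (- x) = sint f 0 + sint f (- 0)"
    by (intro DERIV_isconst_all[of "\<lambda>x. sint f x + sint f (- x)"]) blast
  then show ?thesis by simp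
qed

text \<open>By periodicity the increment of the integral over a length \<open>pi\<close> does not
  depend on the starting point; started at \<open>- pi / 2\<close> it is, by evenness, twice the
  value at \<open>pi / 2\<close>. Two such increments give the factor 4.\<close>

lemma sint_add_period:
  assumes "continuous_on UNIV f" "\<And>x. f (- x) = f x" "\<And>x. f (x + pi) = f x"
  shows "sint f (x + 2 * pi) = sint f x + 4 * sint f (pi / 2)"
proof -
  have "((\<lambda>x. sint f (x + pi) - sint f x) has_real_derivative 0) (at x)" for x
    by (auto intro!: derivative_eq_intros DERIV_chain2[OF sint_has_real_derivative[OF assms(1)]] simp: assms(3))
  then have *: "sint f (x + pi) - sint f x = sint f (- (pi / 2) + pi) - sint f (- (pi / 2))" for x
    by (intro DERIV_isconst_all[of "\<lambda>x. sint f (x + pi) - sint f x"]) blast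
  have **: "sint f (x + pi) = sint f x + 2 * sint f (pi / 2)" for x
    using *[of x] sint_minus[OF assms(1,2), of "pi / 2"] by simp
  have "sint f (x + 2 * pi) = sint f ((x + pi) + pi)" by (simp add: add.assoc)
  then show ?thesis using **[of x] **[of "x + pi"] by linarith
qed

section \<open>Elliptic integrals and amplitude for a fixed modulus\<close>

context
  fixes q :: real
  assumes q: "0 \<le> q" "q < 1"
begin

lemma modulus_pos: "0 < 1 - q^2 * (sin \<theta>)^2"
proof -
  have "q^2 < 1" using q by (simp add: power_less_one_iff abs_square_less_1)
  moreover have "q^2 * (sin \<theta>)^2 \<le> q^2 * 1"
    by (intro mult_left_mono) (auto simp: abs_square_le_1)
  ultimately show ?thesis by linarith
qed

lemma modulus_le_one: "sqrt (1 - q^2 * (sin \<theta>)^2) \<le> 1"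
  by simp

lemma continuous_on_modulus:
  "continuous_on UNIV (\<lambda>\<theta>. sqrt (1 - q^2 * (sin \<theta>)^2))"
  "continuous_on UNIV (\<lambda>\<theta>. 1 / sqrt (1 - q^2 * (sin \<theta>)^2))"
  using modulus_pos by (auto intro!: continuous_intros simp: less_imp_neq[symmetric])

lemma ellE_has_real_derivative: "((\<lambda>x. ellE x q) has_real_derivative sqrt (1 - q^2 * (sin x)^2)) (at x)"
  unfolding ellE_def by (rule sint_has_real_derivative[OF continuous_on_modulus(1)])

lemma ellF_has_real_derivative: "((\<lambda>x. ellF x q) has_real_derivative 1 / sqrt (1 - q^2 * (sin x)^2)) (at x)"
  unfolding ellF_def by (rule sint_has_real_derivative[OF continuous_on_modulus(2)])

text \<open>The integrand is at least 1. This one estimate makes \<open>ellF\<close> strictly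
  increasing, supplies the bounds for its surjectivity, and makes the inverse \<open>am\<close>
  1-Lipschitz, hence continuous.\<close>

lemma ellF_diff_ge:
  assumes "x \<le> y"
  shows "y - x \<le> ellF y q - ellF x q"
proof -
  have "ellF x q - x \<le> ellF y q - y"
  proof (rule DERIV_nonneg_imp_nondecreasing[OF assms])
    fix z
    have "((\<lambda>x. ellF x q - x) has_real_derivative 1 / sqrt (1 - q^2 * (sin z)^2) - 1) (at z)"
      by (intro derivative_intros ellF_has_real_derivative)
    moreover have "0 \<le> 1 / sqrt (1 - q^2 * (sin z)^2) - 1"
      using modulus_le_one[of z] modulus_pos[of z] by (simp add: field_simps)
    ultimately show "\<exists>D. ((\<lambda>x. ellF x q - x) has_real_derivative D) (at z) \<and> 0 \<le> D" by blast
  qed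
  then show ?thesis by simp
qed

lemma ellF_less_iff: "ellF x q < ellF y q \<longleftrightarrow> x < y"
  using ellF_diff_ge[of x y] ellF_diff_ge[of y x] by linarith

lemma ellF_eq_iff: "ellF x q = ellF y q \<longleftrightarrow> x = y"
  using ellF_diff_ge[of x y] ellF_diff_ge[of y x] by linarith

lemma ellF_zero: "ellF 0 q = 0"
  by (simp add: ellF_def)

lemma am_ellF: "am (ellF x q) q = x"
  unfolding am_def by (rule the_equality) (simp_all add: ellF_eq_iff)

lemma ellF_am: "ellF (am u q) q = u"
proof -
  have "\<exists>x. - \<bar>u\<bar> \<le> x \<and> x \<le> \<bar>u\<bar> \<and> ellF x q = u"
  proof (rule IVT)
    show "ellF (- \<bar>u\<bar>) q \<le> u" using ellF_diff_ge[of "- \<bar>u\<bar>" 0] ellF_zero by linarith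
    show "u \<le> ellF \<bar>u\<bar> q" using ellF_diff_ge[of 0 "\<bar>u\<bar>"] ellF_zero by linarith
    show "\<forall>x. - \<bar>u\<bar> \<le> x \<and> x \<le> \<bar>u\<bar> \<longrightarrow> isCont (\<lambda>x. ellF x q) x"
      using DERIV_isCont[OF ellF_has_real_derivative] by blast
  qed simp
  then show ?thesis using am_ellF by auto
qed

lemma am_has_real_derivative: "((\<lambda>u. am u q) has_real_derivative sqrt (1 - q^2 * (sin (am u q))^2)) (at u)"
proof -
  have lip: "\<bar>am x q - am y q\<bar> \<le> \<bar>x - y\<bar>" for x y
    using ellF_diff_ge[of "am x q" "am y q"] ellF_diff_ge[of "am y q" "am x q"]
    by (cases "am x q \<le> am y q") (simp_all add: ellF_am)
  have "isCont (\<lambda>u. am u q) u"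
    unfolding continuous_at_eps_delta dist_real_def
    using lip by (metis order_le_less_trans)
  then have "((\<lambda>u. am u q) has_real_derivative inverse (1 / sqrt (1 - q^2 * (sin (am u q))^2))) (at u)"
    by (intro DERIV_inverse_function[where f="\<lambda>x. ellF x q" and a="u - 1" and b="u + 1"] ellF_has_real_derivative)
      (use modulus_pos[of "am u q"] ellF_am in auto)
  then show ?thesis by simp
qed

lemma sint_modulus:
  "ellF (- x) q = - ellF x q" "ellE (- x) q = - ellE x q"
  "ellF (x + 2 * pi) q = ellF x q + 4 * ellK q" "ellE (x + 2 * pi) q = ellE x q + 4 * ellEc q"
  unfolding ellF_def ellE_def ellK_def ellEc_def
  by (intro sint_minus sint_add_period continuous_on_modulus; simp)+

lemma am_add_period: "am (u + 4 * ellK q) q = am u q + 2 * pi"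
  using am_ellF[of "am u q + 2 * pi"] by (simp add: sint_modulus ellF_am)

lemma am_minus_ellK: "am (- ellK q) q = - (pi / 2)"
  using am_ellF[of "- (pi / 2)"] by (simp add: sint_modulus ellK_def)

lemma ellK_pos: "0 < ellK q"
  using ellF_diff_ge[of 0 "pi / 2"] ellF_zero pi_gt_zero unfolding ellK_def by linarith

lemma cos_am_pos:
  assumes "- ellK q < u" "u < ellK q"
  shows "0 < cos (am u q)"
proof (rule cos_gt_zero_pi)
  show "- (pi / 2) < am u q"
    using ellF_less_iff[of "- (pi / 2)" "am u q"] assms by (simp add: ellF_am sint_modulus ellK_def)
  show "am u q < pi / 2"
    using ellF_less_iff[of "am u q" "pi / 2"] assms by (simp add: ellF_am ellK_def)
qed

end

text \<open>The sign \<open>sg\<close> is 1 for arcs and -1 for the loop: reflecting the first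
  coordinate turns one formula into the other, and the same sign keeps \<open>\<alpha>\<close>
  positive when 2E - K is negative.\<close>

lemma wavelike_elastica_not_local_minimizer:
  assumes q: "0 < q" "q < 1" and sg: "sg = 1 \<or> sg = -1" and "0 < ell"
    and \<alpha>: "0 < \<alpha>" "\<alpha> = 4 / ell * (sg * (2 * ellEc q - ellK q))"
    and lam: "lam = 2 * \<alpha>^2 * (2 * q^2 - 1)"
    and \<gamma>: "\<gamma> \<in> A_ell ell"
    and c: "c = (\<lambda>s. (sg / \<alpha> * (2 * ellE (am (\<alpha> * s - ellK q) q) q + 2 * ellEc q - \<alpha> * s),
              1 / \<alpha> * (2 * q * cn (\<alpha> * s - ellK q) q)))"
    and param: "arclength_param_is \<gamma> c (4 * ellK q / \<alpha>)"
  shows "\<not> local_minimizer lam ell \<gamma>"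
proof -
  have q': "0 \<le> q" "q < 1" using q by auto
  note pos = modulus_pos[OF q']
  define \<phi> where "\<phi> s = am (\<alpha> * s - ellK q) q" for s
  define S where "S s = sin (\<phi> s)" for s
  define C where "C s = cos (\<phi> s)" for s
  define R where "R s = sqrt (1 - q^2 * (S s)^2)" for s
  \<comment> \<open>Since \<open>\<phi>\<close> has derivative \<open>\<alpha> * R s\<close>, the
    elliptic integral of the second kind along \<open>\<phi>\<close> has derivative
    \<open>\<alpha> * (R s)^2\<close>; this produces the tangent below, and differentiating it
    produces \<open>k\<close>.\<close>
  define T where "T s = (sg * (1 - 2 * q^2 * (S s)^2), - 2 * q * S s * R s)" for s
  define N where "N s = (2 * q * S s * R s, sg * (1 - 2 * q^2 * (S s)^2))" for s
  define k where "k s = - sg * 2 * q * \<alpha> * C s" for s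
  define k' where "k' s = sg * 2 * q * \<alpha>^2 * S s * R s" for s
  have sg2: "sg * sg = 1" "sg^2 = 1" using sg by auto
  have R2: "R s * R s = 1 - q^2 * (S s)^2" "(R s)^2 = 1 - q^2 * (S s)^2" for s
    using pos[of "\<phi> s"] by (simp_all add: R_def S_def)
  have Rpos: "R s > 0" for s using pos[of "\<phi> s"] by (simp add: R_def S_def)
  have C2: "(C s)^2 = 1 - (S s)^2" for s by (simp add: C_def S_def cos_squared_eq)
  have d\<phi>: "(\<phi> has_real_derivative \<alpha> * R s) (at s)" for s
    unfolding \<phi>_def R_def S_def
    by (rule DERIV_cong[OF DERIV_chain2[OF am_has_real_derivative[OF q']]])
      (auto intro!: derivative_eq_intros)
  have dS: "(S has_real_derivative C s * (\<alpha> * R s)) (at s)" for s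
    unfolding S_def C_def by (auto intro!: derivative_eq_intros d\<phi>)
  have dC: "(C has_real_derivative - S s * (\<alpha> * R s)) (at s)" for s
    unfolding S_def C_def by (auto intro!: derivative_eq_intros d\<phi>)
  have dR: "(R has_real_derivative - (q^2) * S s * C s * \<alpha>) (at s)" for s
  proof -
    have "((\<lambda>s. 1 - q^2 * (S s)^2) has_real_derivative - (q^2 * (2 * S s * (C s * (\<alpha> * R s))))) (at s)"
      by (rule derivative_eq_intros dS refl)+ simp
    from DERIV_chain2[OF DERIV_real_sqrt this] pos[of "\<phi> s"]
    have "((\<lambda>s. sqrt (1 - q^2 * (S s)^2)) has_real_derivative
      inverse (R s) / 2 * (- (q^2 * (2 * S s * (C s * (\<alpha> * R s)))))) (at s)"
      unfolding R_def S_def by simp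
    then have "(R has_real_derivative inverse (R s) / 2 * (- (q^2 * (2 * S s * (C s * (\<alpha> * R s)))))) (at s)"
      by (simp add: R_def[abs_def])
    then show ?thesis
      by (rule DERIV_cong) (use Rpos[of s] in \<open>simp add: field_simps\<close>)
  qed
  have dE: "((\<lambda>s. ellE (\<phi> s) q) has_real_derivative \<alpha> * (1 - q^2 * (S s)^2)) (at s)" for s
    by (rule DERIV_cong[OF DERIV_chain2[OF ellE_has_real_derivative[OF q'] d\<phi>]])
      (use pos[of "\<phi> s"] in \<open>simp add: R_def S_def\<close>)
  have ceq: "c = (\<lambda>s. (sg / \<alpha> * (2 * ellE (\<phi> s) q + 2 * ellEc q - \<alpha> * s), 1 / \<alpha> * (2 * q * C s)))"
    unfolding c \<phi>_def C_def cn_def ..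
  have pairD: "((\<lambda>s. (x s, y s)) has_vector_derivative (x', y')) (at s)"
    if "(x has_real_derivative x') (at s)" "(y has_real_derivative y') (at s)" for x y :: "real \<Rightarrow> real" and x' y' s
    using that unfolding has_real_derivative_iff_has_vector_derivative by (rule has_vector_derivative_Pair)
  have Tdec: "T = (\<lambda>s. (sg * (1 - 2 * q^2 * (S s)^2), - 2 * q * S s * R s))" by (rule ext, rule T_def)
  have Ndec: "N = (\<lambda>s. (2 * q * S s * R s, sg * (1 - 2 * q^2 * (S s)^2)))" by (rule ext, rule N_def)
  have kdec: "k = (\<lambda>s. - sg * 2 * q * \<alpha> * C s)" by (rule ext, rule k_def)
  have dc: "(c has_vector_derivative T s) (at s)" for s
    unfolding ceq T_def
  proof (rule pairD)
    show "((\<lambda>s. sg / \<alpha> * (2 * ellE (\<phi> s) q + 2 * ellEc q - \<alpha> * s)) has_real_derivative sg * (1 - 2 * q\<^sup>2 * (S s)\<^sup>2)) (at s)"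
      by (rule derivative_eq_intros dE refl)+ (use \<alpha>(1) in \<open>simp add: field_simps\<close>)
    show "((\<lambda>s. 1 / \<alpha> * (2 * q * C s)) has_real_derivative - 2 * q * S s * R s) (at s)"
      by (rule derivative_eq_intros dC refl)+ (use \<alpha>(1) in \<open>simp add: field_simps\<close>)
  qed
  have dq: "((\<lambda>s. 1 - 2 * q^2 * (S s)^2) has_real_derivative - 4 * q^2 * \<alpha> * S s * C s * R s) (at s)" for s
    by (rule derivative_eq_intros dS refl)+ (simp add: algebra_simps)
  have dSR: "((\<lambda>s. S s * R s) has_real_derivative \<alpha> * C s * (1 - 2 * q^2 * (S s)^2)) (at s)" for s
  proof (rule DERIV_cong[OF DERIV_mult[OF dS dR]])
    have "C s * (\<alpha> * R s) * R s + - q\<^sup>2 * S s * C s * \<alpha> * S s = \<alpha> * C s * (R s * R s - q\<^sup>2 * (S s)\<^sup>2)"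
      by (simp add: algebra_simps power2_eq_square)
    then show "C s * (\<alpha> * R s) * R s + - q\<^sup>2 * S s * C s * \<alpha> * S s = \<alpha> * C s * (1 - 2 * q\<^sup>2 * (S s)\<^sup>2)"
      unfolding R2 by simp
  qed
  have dT: "(T has_vector_derivative k s *\<^sub>R N s) (at s)" for s
  proof -
    have "(T has_vector_derivative (sg * (- 4 * q^2 * \<alpha> * S s * C s * R s), - 2 * q * (\<alpha> * C s * (1 - 2 * q^2 * (S s)^2)))) (at s)"
      unfolding Tdec mult.assoc[of "- 2 * q"] by (intro pairD DERIV_cmult dq dSR)
    also have "(sg * (- 4 * q^2 * \<alpha> * S s * C s * R s), - 2 * q * (\<alpha> * C s * (1 - 2 * q^2 * (S s)^2))) = k s *\<^sub>R N s"
      unfolding k_def N_def using sg by (auto simp: power2_eq_square algebra_simps)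
    finally show ?thesis .
  qed
  have dN: "(N has_vector_derivative - k s *\<^sub>R T s) (at s)" for s
  proof -
    have "(N has_vector_derivative (2 * q * (\<alpha> * C s * (1 - 2 * q^2 * (S s)^2)), sg * (- 4 * q^2 * \<alpha> * S s * C s * R s))) (at s)"
      unfolding Ndec mult.assoc[of "2 * q"] by (intro pairD DERIV_cmult dq dSR)
    also have "(2 * q * (\<alpha> * C s * (1 - 2 * q^2 * (S s)^2)), sg * (- 4 * q^2 * \<alpha> * S s * C s * R s)) = - k s *\<^sub>R T s"
      unfolding k_def T_def using sg by (auto simp: power2_eq_square algebra_simps)
    finally show ?thesis .
  qed
  have dk: "(k has_real_derivative k' s) (at s)" for s
    unfolding kdec k'_def by (rule derivative_eq_intros dC refl)+ (simp add: power2_eq_square algebra_simps)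
  \<comment> \<open>Along the full length the amplitude runs from -pi/2 to 3 pi/2, one complete
    period, and its cosine, hence the curvature, vanishes at both ends.\<close>
  have per\<phi>: "\<phi> (s + 4 * ellK q / \<alpha>) = \<phi> s + 2 * pi" for s
  proof -
    have "\<alpha> * (s + 4 * ellK q / \<alpha>) - ellK q = (\<alpha> * s - ellK q) + 4 * ellK q"
      using \<alpha>(1) by (simp add: field_simps)
    then show ?thesis unfolding \<phi>_def by (simp only: am_add_period[OF q'])
  qed
  have perS: "S (s + 4 * ellK q / \<alpha>) = S s" "C (s + 4 * ellK q / \<alpha>) = C s" for s
    unfolding S_def C_def per\<phi> by simp_all
  have \<phi>0: "\<phi> 0 = - (pi / 2)" by (simp add: \<phi>_def am_minus_ellK[OF q'])
  have E0: "ellE (\<phi> 0) q = - ellEc q" unfolding \<phi>0 ellEc_def by (rule sint_modulus(2)[OF q'])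
  have \<phi>L: "\<phi> (4 * ellK q / \<alpha>) = \<phi> 0 + 2 * pi" using per\<phi>[of 0] by simp
  show ?thesis
  proof (rule periodic_elastica_not_local_minimizer[OF dc dT dN dk])
    show "norm (T s) = 1" for s
    proof -
      have "(sg * (1 - 2 * q\<^sup>2 * (S s)\<^sup>2))\<^sup>2 + (- 2 * q * S s * R s)\<^sup>2
        = (1 - 2 * q\<^sup>2 * (S s)\<^sup>2)\<^sup>2 + 4 * q\<^sup>2 * (S s)\<^sup>2 * (1 - q\<^sup>2 * (S s)\<^sup>2)"
        by (simp add: power_mult_distrib sg2 R2)
      also have "\<dots> = 1" by algebra
      finally show ?thesis by (simp add: T_def norm_prod_def)
    qed
    show "N s = (- snd (T s), fst (T s))" for s by (simp add: N_def T_def)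
    \<comment> \<open>The value of \<open>lam\<close> gives
      \<open>lam - (k s)^2 = - 2 * \<alpha>^2 * (1 - 2 * q^2 * (S s)^2)\<close>. With it the second
      component cancels, and the first is \<open>- 2 * sg * \<alpha>^2\<close> times the squared
      norm of \<open>T s\<close>.\<close>
    show "(lam - (k s)\<^sup>2) *\<^sub>R T s - (2 * k' s) *\<^sub>R N s = (- 2 * sg * \<alpha>^2, 0)" for s
    proof -
      have k2: "(k s)\<^sup>2 = 4 * q^2 * \<alpha>^2 * (1 - (S s)^2)"
        unfolding k_def by (simp add: power_mult_distrib sg2 C2)
      have "(lam - (k s)\<^sup>2) * (sg * (1 - 2 * q^2 * (S s)^2)) - 2 * k' s * (2 * q * S s * R s)
        = sg * ((lam - (k s)\<^sup>2) * (1 - 2 * q^2 * (S s)^2) - 8 * q^2 * \<alpha>^2 * (S s)^2 * (R s)^2)"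
        unfolding k'_def by (simp add: power2_eq_square algebra_simps)
      also have "\<dots> = - 2 * sg * \<alpha>^2" unfolding R2 k2 lam by algebra
      finally have 1: "(lam - (k s)\<^sup>2) * (sg * (1 - 2 * q^2 * (S s)^2)) - 2 * k' s * (2 * q * S s * R s) = - 2 * sg * \<alpha>^2" .
      have "(lam - (k s)\<^sup>2) * (- 2 * q * S s * R s) - 2 * k' s * (sg * (1 - 2 * q^2 * (S s)^2))
        = (- 2 * q * S s * R s) * (lam - (k s)^2 + 2 * \<alpha>^2 * (sg * sg) * (1 - 2 * q^2 * (S s)^2))"
        unfolding k'_def by (simp add: power2_eq_square algebra_simps)
      also have "\<dots> = 0" unfolding k2 lam sg2 by algebra
      finally have 2: "(lam - (k s)\<^sup>2) * (- 2 * q * S s * R s) - 2 * k' s * (sg * (1 - 2 * q^2 * (S s)^2)) = 0" .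
      show ?thesis by (simp only: T_def N_def scaleR_Pair diff_Pair real_scaleR_def 1 2)
    qed
    show "T (s + 4 * ellK q / \<alpha>) = T s" "k (s + 4 * ellK q / \<alpha>) = k s" for s
      by (simp_all add: T_def k_def R_def perS)
    show "0 < 4 * ellK q / \<alpha>" using ellK_pos[OF q'] \<alpha>(1) by simp
    show "c 0 = (0, 0)" unfolding ceq C_def by (simp add: E0, simp add: \<phi>0)
    show "c (4 * ellK q / \<alpha>) = (ell, 0)"
    proof -
      have "sg / \<alpha> * (2 * ellE (\<phi> (4 * ellK q / \<alpha>)) q + 2 * ellEc q - \<alpha> * (4 * ellK q / \<alpha>))
         = sg / \<alpha> * (8 * ellEc q - 4 * ellK q)"
        using \<alpha>(1) by (simp add: \<phi>L sint_modulus(4)[OF q'] E0)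
      also have "\<dots> = ell"
      proof -
        \<comment> \<open>\<open>\<alpha>\<close> is normalized so that the horizontal advance over
          one period is \<open>ell\<close>.\<close>
        have "ell * \<alpha> = sg * (8 * ellEc q - 4 * ellK q)"
          using \<open>0 < ell\<close> by (subst \<alpha>(2)) (simp add: field_simps)
        then show ?thesis using \<alpha>(1) by (simp add: field_simps)
      qed
      finally show ?thesis unfolding ceq C_def by (simp add: \<phi>L, simp add: \<phi>0)
    qed
    show "\<exists>e. 0 < e \<and> e < d \<and> k e \<noteq> 0" if "d > 0" for d
    proof (intro exI conjI)
      \<comment> \<open>The bound \<open>ellK q / \<alpha>\<close> places
        \<open>\<alpha> * ?e - ellK q\<close> strictly between \<open>- ellK q\<close> and
        \<open>ellK q\<close>, where the cosine of the amplitude is positive; halving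
        \<open>d\<close> gives the strict inequality.\<close>
      let ?e = "min (d / 2) (ellK q / \<alpha>)"
      show e: "0 < ?e" using that ellK_pos[OF q'] \<alpha>(1) by simp
      show "?e < d" using that by simp
      have "\<alpha> * ?e \<le> \<alpha> * (ellK q / \<alpha>)" using \<alpha>(1) by (intro mult_left_mono) auto
      moreover have "0 < \<alpha> * ?e" using e \<alpha>(1) by (rule mult_pos_pos[rotated])
      ultimately have "0 < C ?e"
        unfolding C_def \<phi>_def using \<alpha>(1) ellK_pos[OF q'] by (intro cos_am_pos[OF q']) auto
      then show "k ?e \<noteq> 0" using q \<alpha>(1) sg by (auto simp: k_def)
    qed
    show "\<gamma> \<in> A_ell ell" by fact
    show "\<gamma> t = c (arclen \<gamma> t)" if "t \<in> {0..1}" for t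
      using param that unfolding arclength_param_is_def by blast
    show "arclen \<gamma> 1 = 4 * ellK q / \<alpha>"
      using param unfolding arclength_param_is_def arclen_def curve_length_def by blast
  qed
qed

section \<open>The function 2E - K of the parameter\<close>

text \<open>\<open>elliptic_m w\<close> is \<open>2E - K\<close> as a function of \<open>w = q\<^sup>2\<close>, in which its integrand is concave
  and decreasing; \<open>elliptic_m'\<close> is its derivative.\<close>

definition elliptic_m :: "real \<Rightarrow> real" where
  "elliptic_m w = integral {0..pi/2} (\<lambda>\<theta>. 2 * sqrt (1 - w * (sin \<theta>)^2) - 1 / sqrt (1 - w * (sin \<theta>)^2))"

definition elliptic_m' :: "real \<Rightarrow> real" where
  "elliptic_m' w = integral {0..pi/2} (\<lambda>\<theta>. - ((sin \<theta>)^2) *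
     (1 / sqrt (1 - w * (sin \<theta>)^2) + 1 / (2 * sqrt (1 - w * (sin \<theta>)^2) ^ 3)))"

text \<open>Negative \<open>w\<close> are included so that derivatives at 0 are two-sided and
  parameter ranges of the form \<open>{..b}\<close> are allowed.\<close>

lemma parameter_pos:
  assumes "w < 1"
  shows "0 < 1 - w * (sin (\<theta>::real))^2"
proof (cases "0 \<le> w")
  case True
  have "w * (sin \<theta>)^2 \<le> w * 1"
    by (intro mult_left_mono) (use True in \<open>auto simp: abs_square_le_1\<close>)
  then show ?thesis using assms by linarith
next
  case False
  then have "w * (sin \<theta>)^2 \<le> 0" by (intro mult_nonpos_nonneg) auto
  then show ?thesis by linarith
qed

lemma continuous_on_elliptic_integrands:
  assumes "w < 1"
  shows "continuous_on A (\<lambda>\<theta>. sqrt (1 - w * (sin \<theta>)^2))"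
    "continuous_on A (\<lambda>\<theta>. 1 / sqrt (1 - w * (sin \<theta>)^2))"
    "continuous_on A (\<lambda>\<theta>. 1 / sqrt (1 - w * (sin \<theta>)^2) ^ 3)"
  using parameter_pos[OF assms] by (auto intro!: continuous_intros simp: less_imp_neq[symmetric])

lemma elliptic_m_eq:
  assumes "0 \<le> q" "q < 1"
  shows "2 * ellEc q - ellK q = elliptic_m (q^2)"
proof -
  have w: "q^2 < 1" using assms by (simp add: power_less_one_iff abs_square_less_1)
  note i = integrable_continuous_real[OF continuous_on_elliptic_integrands(1)[OF w]]
    integrable_continuous_real[OF continuous_on_elliptic_integrands(2)[OF w]]
  show ?thesis
    unfolding ellEc_def ellK_def ellE_def ellF_def sint_def elliptic_m_def
    by (subst integral_diff) (auto intro!: integrable_on_mult_right i)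
qed

lemma continuous_on_elliptic_param:
  assumes "b < 1"
  shows "continuous_on ({..b} \<times> A) (\<lambda>(w, \<theta>). - ((sin \<theta>)^2) *
     (1 / sqrt (1 - w * (sin \<theta>)^2) + 1 / (2 * sqrt (1 - w * (sin \<theta>)^2) ^ 3)))"
proof -
  have "0 < 1 - w * (sin (\<theta>::real))^2" if "w \<le> b" for w \<theta>
    using parameter_pos[of w \<theta>] that assms by linarith
  then have "sqrt (1 - w * (sin \<theta>)^2) \<noteq> 0" if "w \<le> b" for w \<theta> :: real
    using that by (metis less_irrefl real_sqrt_eq_zero_cancel_iff)
  then show ?thesis
    unfolding case_prod_beta by (intro continuous_intros) auto
qed

lemma elliptic_m_has_derivative:
  assumes "w < 1"
  shows "(elliptic_m has_real_derivative elliptic_m' w) (at w)"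
proof -
  \<comment> \<open>The midpoint makes \<open>{..b}\<close> a neighbourhood of \<open>w\<close> that
    stays away from the singular parameter 1.\<close>
  define b where "b = (w + 1) / 2"
  have b: "w < b" "b < 1" using assms by (auto simp: b_def)
  have "((\<lambda>w. integral (cbox 0 (pi/2)) (\<lambda>\<theta>. 2 * sqrt (1 - w * (sin \<theta>)^2) - 1 / sqrt (1 - w * (sin \<theta>)^2)))
     has_real_derivative integral (cbox 0 (pi/2)) (\<lambda>\<theta>. - ((sin \<theta>)^2) *
     (1 / sqrt (1 - w * (sin \<theta>)^2) + 1 / (2 * sqrt (1 - w * (sin \<theta>)^2) ^ 3)))) (at w within {..b})"
  proof (rule leibniz_rule_field_derivative)
    fix x \<theta> :: real assume "x \<in> {..b}"
    then have x: "x < 1" using b by auto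
    define y where "y = sqrt (1 - x * (sin \<theta>)^2)"
    have y: "y > 0" using parameter_pos[OF x] by (simp add: y_def)
    have d: "((\<lambda>x. sqrt (1 - x * (sin \<theta>)^2)) has_real_derivative - ((sin \<theta>)^2) / (2 * y)) (at x)"
    proof -
      have "((\<lambda>x. 1 - x * (sin \<theta>)^2) has_real_derivative - ((sin \<theta>)^2)) (at x)"
        by (auto intro!: derivative_eq_intros)
      from DERIV_chain2[where f = sqrt and g = "\<lambda>x. 1 - x * (sin \<theta>)^2", OF DERIV_real_sqrt[OF parameter_pos[OF x]] this]
      show ?thesis by (rule DERIV_cong) (simp add: y_def field_simps)
    qed
    have "((\<lambda>x. 2 * sqrt (1 - x * (sin \<theta>)^2) - 1 / sqrt (1 - x * (sin \<theta>)^2)) has_real_derivative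
        - ((sin \<theta>)^2) * (1 / y + 1 / (2 * y ^ 3))) (at x)"
    proof -
      have "((\<lambda>t. 2 * t - 1 / t) has_real_derivative 2 + 1 / y^2) (at (sqrt (1 - x * (sin \<theta>)^2)))"
        using y unfolding y_def by (auto intro!: derivative_eq_intros simp: power2_eq_square)
      from DERIV_chain2[where f = "\<lambda>t. 2 * t - 1 / t" and g = "\<lambda>x. sqrt (1 - x * (sin \<theta>)^2)", OF this d]
      show ?thesis
        by (rule DERIV_cong) (use y in \<open>simp add: field_simps power2_eq_square power3_eq_cube\<close>)
    qed
    then show "((\<lambda>x. 2 * sqrt (1 - x * (sin \<theta>)^2) - 1 / sqrt (1 - x * (sin \<theta>)^2)) has_real_derivative
        - ((sin \<theta>)^2) * (1 / sqrt (1 - x * (sin \<theta>)^2) + 1 / (2 * sqrt (1 - x * (sin \<theta>)^2) ^ 3))) (at x within {..b})"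
      unfolding y_def by (rule has_field_derivative_at_within)
  next
    fix x assume "x \<in> {..b}"
    then have x: "x < 1" using b by auto
    show "(\<lambda>\<theta>. 2 * sqrt (1 - x * (sin \<theta>)^2) - 1 / sqrt (1 - x * (sin \<theta>)^2)) integrable_on cbox 0 (pi/2)"
      unfolding cbox_interval
      by (intro integrable_continuous_real continuous_intros continuous_on_elliptic_integrands[OF x])
  next
    show "continuous_on ({..b} \<times> cbox 0 (pi/2)) (\<lambda>(w, \<theta>). - ((sin \<theta>)^2) *
     (1 / sqrt (1 - w * (sin \<theta>)^2) + 1 / (2 * sqrt (1 - w * (sin \<theta>)^2) ^ 3)))"
      by (rule continuous_on_elliptic_param[OF b(2)])
  qed (use b in auto)
  moreover have "at w within {..b} = at w"
    by (rule at_within_interior) (use b in auto)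
  ultimately show ?thesis unfolding elliptic_m_def[abs_def] elliptic_m'_def by simp
qed

lemma continuous_on_elliptic_m':
  assumes "b < 1"
  shows "continuous_on {..b} elliptic_m'"
  unfolding elliptic_m'_def[abs_def] cbox_interval[symmetric]
  by (rule integral_continuous_on_param[OF continuous_on_elliptic_param[OF assms]])

lemma integral_trig_squares:
  "((\<lambda>\<theta>. (sin \<theta>)^2) has_integral pi/4) {0..pi/2}" "((\<lambda>\<theta>. (cos \<theta>)^2) has_integral pi/4) {0..pi/2}"
proof -
  have "((\<lambda>\<theta>. (sin \<theta>)^2) has_integral ((pi/2 - sin (pi/2) * cos (pi/2)) / 2 - (0 - sin 0 * cos 0) / 2)) {0..pi/2}"
  proof (rule fundamental_theorem_of_calculus)
    fix x :: real
    have "((\<lambda>x. (x - sin x * cos x) / 2) has_real_derivative (1 - (cos x * cos x - sin x * sin x)) / 2) (at x within {0..pi/2})"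
      by (auto intro!: derivative_eq_intros)
    also have "(1 - (cos x * cos x - sin x * sin x)) / 2 = (sin x)^2"
      using sin_cos_squared_add[of x] by (simp add: power2_eq_square)
    finally show "((\<lambda>x. (x - sin x * cos x) / 2) has_vector_derivative (sin x)^2) (at x within {0..pi/2})"
      unfolding has_real_derivative_iff_has_vector_derivative .
  qed simp
  then show s: "((\<lambda>\<theta>. (sin \<theta>)^2) has_integral pi/4) {0..pi/2}" by simp
  have "((\<lambda>\<theta>. 1 - ((sin \<theta>)^2)) has_integral (1 * (pi/2 - 0) - pi/4)) {0..pi/2}"
    by (intro has_integral_diff s) (use has_integral_const_real[of "1::real" 0 "pi/2"] in simp)
  then show "((\<lambda>\<theta>. (cos \<theta>)^2) has_integral pi/4) {0..pi/2}" by (simp add: cos_squared_eq)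
qed

lemma elliptic_m'_integrable:
  assumes "w < 1"
  shows "(\<lambda>\<theta>. - ((sin \<theta>)^2) * (1 / sqrt (1 - w * (sin \<theta>)^2) + 1 / (2 * sqrt (1 - w * (sin \<theta>)^2) ^ 3))) integrable_on {0..pi/2}"
  using parameter_pos[OF assms]
  by (intro integrable_continuous_real continuous_intros) (auto simp: less_imp_neq[symmetric])

text \<open>The square root is at most 1, so the bracket in the integrand is at least 1 and
  comparison with the integral of \<open>- ((sin \<theta>)^2)\<close> suffices.\<close>

lemma elliptic_m'_neg:
  assumes "0 \<le> w" "w < 1"
  shows "elliptic_m' w < 0"
proof -
  have "elliptic_m' w \<le> integral {0..pi/2} (\<lambda>\<theta>. - ((sin \<theta>)^2))"
    unfolding elliptic_m'_def
  proof (rule integral_le[OF elliptic_m'_integrable[OF assms(2)]])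
    show "(\<lambda>\<theta>. - ((sin \<theta>)^2)) integrable_on {0..pi/2}"
      by (intro integrable_continuous_real continuous_intros)
    fix \<theta> :: real
    define y where "y = sqrt (1 - w * (sin \<theta>)^2)"
    have y: "0 < y" "y \<le> 1" using parameter_pos[OF assms(2)] assms(1) by (auto simp: y_def)
    then have "1 \<le> 1 / y + 1 / (2 * y ^ 3)" by (simp add: add_increasing2)
    then have "(sin \<theta>)^2 * 1 \<le> (sin \<theta>)^2 * (1 / y + 1 / (2 * y ^ 3))" by (intro mult_left_mono) auto
    then show "- ((sin \<theta>)^2) * (1 / sqrt (1 - w * (sin \<theta>)^2) + 1 / (2 * sqrt (1 - w * (sin \<theta>)^2) ^ 3)) \<le> - ((sin \<theta>)^2)"
      unfolding y_def by simp
  qed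
  also have "\<dots> = - (pi / 4)"
    using has_integral_neg[OF integral_trig_squares(1)] by (rule integral_unique)
  finally show ?thesis using pi_gt_zero by linarith
qed

lemma elliptic_m'_antimono:
  assumes "w \<le> w'" "w' < 1"
  shows "elliptic_m' w' \<le> elliptic_m' w"
  unfolding elliptic_m'_def
proof (rule integral_le[OF elliptic_m'_integrable elliptic_m'_integrable])
  fix \<theta> :: real
  define y where "y = sqrt (1 - w * (sin \<theta>)^2)"
  define y' where "y' = sqrt (1 - w' * (sin \<theta>)^2)"
  have "y' \<le> y" unfolding y_def y'_def using assms by (auto intro: mult_right_mono)
  moreover have "0 < y'" using parameter_pos[OF assms(2)] by (simp add: y'_def)
  ultimately have "1 / y + 1 / (2 * y ^ 3) \<le> 1 / y' + 1 / (2 * y' ^ 3)"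
    by (intro add_mono divide_left_mono mult_left_mono power_mono mult_pos_pos zero_less_power) auto
  then have "(sin \<theta>)^2 * (1 / y + 1 / (2 * y ^ 3)) \<le> (sin \<theta>)^2 * (1 / y' + 1 / (2 * y' ^ 3))"
    by (intro mult_left_mono) auto
  then show "- ((sin \<theta>)^2) * (1 / sqrt (1 - w' * (sin \<theta>)^2) + 1 / (2 * sqrt (1 - w' * (sin \<theta>)^2) ^ 3))
    \<le> - ((sin \<theta>)^2) * (1 / sqrt (1 - w * (sin \<theta>)^2) + 1 / (2 * sqrt (1 - w * (sin \<theta>)^2) ^ 3))"
    unfolding y_def y'_def by simp
qed (use assms in auto)

lemma elliptic_m_strict_antimono:
  assumes "0 \<le> w" "w < w'" "w' < 1"
  shows "elliptic_m w' < elliptic_m w"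
proof (rule DERIV_neg_imp_decreasing[OF assms(2)])
  fix x assume "w \<le> x" "x \<le> w'"
  then show "\<exists>y. (elliptic_m has_real_derivative y) (at x) \<and> y < 0"
    using elliptic_m_has_derivative[of x] elliptic_m'_neg[of x] assms by (intro exI[of _ "elliptic_m' x"]) auto
qed

text \<open>At \<open>w = 1/2\<close>, with \<open>y\<close> the square root, the integrand is
  \<open>(2 * y^2 - 1) / y\<close>. Its numerator equals \<open>(cos \<theta>)^2\<close> and
  \<open>y\<close> is at most 1, so the integral is at least pi/4.\<close>

lemma elliptic_m_half_pos: "0 < elliptic_m (1/2)"
proof -
  have "pi / 4 \<le> elliptic_m (1/2)"
    unfolding elliptic_m_def integral_unique[OF integral_trig_squares(2), symmetric]
  proof (rule integral_le)
    show "(\<lambda>\<theta>. (cos \<theta>)^2) integrable_on {0..pi/2}" using integral_trig_squares(2) by blast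
    show "(\<lambda>\<theta>. 2 * sqrt (1 - 1/2 * (sin \<theta>)^2) - 1 / sqrt (1 - 1/2 * (sin \<theta>)^2)) integrable_on {0..pi/2}"
      by (intro integrable_continuous_real continuous_on_diff continuous_on_mult continuous_on_const continuous_on_elliptic_integrands) auto
    fix \<theta> :: real
    define y where "y = sqrt (1 - 1/2 * (sin \<theta>)^2)"
    have y: "0 < y" "y \<le> 1" "y * y = 1 - 1/2 * (sin \<theta>)^2"
      using parameter_pos[of "1/2" \<theta>] by (auto simp: y_def)
    have "(cos \<theta>)^2 = 2 * (y * y) - 1" unfolding y(3) by (simp add: cos_squared_eq)
    also have "\<dots> \<le> (2 * (y * y) - 1) / y"
    proof -
      have "0 \<le> 2 * (y * y) - 1" unfolding y(3) by (simp add: abs_square_le_1)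
      then have "(2 * (y * y) - 1) * y \<le> (2 * (y * y) - 1) * 1" using y by (intro mult_left_mono) auto
      then show ?thesis by (simp only: pos_le_divide_eq[OF y(1)] mult_1_right)
    qed
    also have "\<dots> = 2 * y - 1 / y" using y(1) by (simp add: diff_divide_distrib)
    finally show "(cos \<theta>)^2 \<le> 2 * sqrt (1 - 1/2 * (sin \<theta>)^2) - 1 / sqrt (1 - 1/2 * (sin \<theta>)^2)"
      unfolding y_def .
  qed
  then show ?thesis using pi_gt_zero by linarith
qed

text \<open>The logarithmic divergence of K at modulus 1, with \<open>r\<close> the complementary
  modulus. The radicand is \<open>(cos \<theta>)^2 + r^2 * (sin \<theta>)^2\<close>, at most
  \<open>(pi/2 - \<theta> + r)^2\<close>, and the reciprocal of \<open>pi/2 - \<theta> + r\<close>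
  integrates to a logarithm.\<close>

lemma elliptic_m_le_ln:
  assumes r: "0 < r" "r \<le> 1"
  shows "elliptic_m (1 - r^2) \<le> pi + ln r"
proof -
  let ?w = "1 - r^2"
  have w: "0 \<le> ?w" "?w < 1" using r by (auto simp: power_le_one)
  have L: "((\<lambda>\<theta>. 1 / (pi/2 - \<theta> + r)) has_integral (- ln (pi/2 - pi/2 + r) - (- ln (pi/2 - 0 + r)))) {0..pi/2}"
  proof (rule fundamental_theorem_of_calculus)
    fix x :: real assume "x \<in> {0..pi/2}"
    then have "pi/2 - x + r > 0" using r by auto
    then have "((\<lambda>x. - ln (pi/2 - x + r)) has_real_derivative 1 / (pi/2 - x + r)) (at x within {0..pi/2})"
      by (auto intro!: derivative_eq_intros)
    then show "((\<lambda>x. - ln (pi/2 - x + r)) has_vector_derivative 1 / (pi/2 - x + r)) (at x within {0..pi/2})"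
      unfolding has_real_derivative_iff_has_vector_derivative .
  qed simp
  have "elliptic_m ?w \<le> integral {0..pi/2} (\<lambda>\<theta>. 2 - 1 / (pi/2 - \<theta> + r))"
    unfolding elliptic_m_def
  proof (rule integral_le)
    show "(\<lambda>\<theta>. 2 * sqrt (1 - ?w * (sin \<theta>)^2) - 1 / sqrt (1 - ?w * (sin \<theta>)^2)) integrable_on {0..pi/2}"
      by (intro integrable_continuous_real continuous_on_diff continuous_on_mult continuous_on_const continuous_on_elliptic_integrands w)
    show "(\<lambda>\<theta>. 2 - 1 / (pi/2 - \<theta> + r)) integrable_on {0..pi/2}"
      by (intro integrable_diff integrable_const_ivl has_integral_integrable[OF L])
    fix \<theta> assume t: "\<theta> \<in> {0..pi/2}"
    define y where "y = sqrt (1 - ?w * (sin \<theta>)^2)"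
    have y: "0 < y" "y \<le> 1" using parameter_pos[OF w(2), of \<theta>] w(1) by (auto simp: y_def)
    have "cos \<theta> = sin (pi/2 - \<theta>)" by (simp add: sin_diff)
    also have "\<dots> \<le> pi/2 - \<theta>" using t by (intro sin_x_le_x) auto
    finally have cs: "cos \<theta> \<le> pi/2 - \<theta>" .
    have c0: "0 \<le> cos \<theta>" using t by (intro cos_ge_zero) auto
    have "1 - ?w * (sin \<theta>)^2 = (cos \<theta>)^2 + r^2 * (sin \<theta>)^2" by (simp add: cos_squared_eq algebra_simps)
    also have "\<dots> \<le> (cos \<theta>)^2 + r^2 * 1" by (intro add_left_mono mult_left_mono) (auto simp: abs_square_le_1)
    also have "\<dots> \<le> (cos \<theta> + r)^2" using c0 r by (simp add: power2_sum)
    also have "\<dots> \<le> (pi/2 - \<theta> + r)^2" using cs c0 r by (intro power_mono) auto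
    finally have "y \<le> pi/2 - \<theta> + r" unfolding y_def using t r by (intro real_le_lsqrt) auto
    then have "1 / (pi/2 - \<theta> + r) \<le> 1 / y" using y by (intro divide_left_mono) auto
    then have "2 * y - 1 / y \<le> 2 - 1 / (pi/2 - \<theta> + r)" using y by linarith
    then show "2 * sqrt (1 - ?w * (sin \<theta>)^2) - 1 / sqrt (1 - ?w * (sin \<theta>)^2) \<le> 2 - 1 / (pi/2 - \<theta> + r)"
      unfolding y_def .
  qed
  also have "\<dots> = pi - (- ln r + ln (pi/2 + r))"
    using has_integral_diff[OF has_integral_const_real[of "2::real" 0 "pi/2"] L] by (simp add: integral_unique)
  also have "\<dots> \<le> pi + ln r"
  proof -
    have "1 \<le> pi/2 + r" using pi_ge_two r by linarith
    then have "0 \<le> ln (pi/2 + r)" by (rule ln_ge_zero)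
    then show ?thesis by linarith
  qed
  finally show ?thesis .
qed

text \<open>With \<open>w = q\<^sup>2\<close>, the function \<open>g\<close> has the derivative \<open>16 m \<psi>\<close> in \<open>w\<close>, and \<open>f\<close> is a positive
  multiple of \<open>\<psi>\<close>.\<close>

definition elliptic_psi :: "real \<Rightarrow> real" where
  "elliptic_psi w = elliptic_m' w * (2 * w - 1) + elliptic_m w"

text \<open>The factor \<open>elliptic_m'\<close> is negative and nonincreasing while
  \<open>2 * w - 1\<close> is nonnegative and increasing, so their product does not increase;
  strictness comes from the summand \<open>elliptic_m\<close>.\<close>

lemma elliptic_psi_strict_antimono:
  assumes "1/2 \<le> w" "w < w'" "w' < 1"
  shows "elliptic_psi w' < elliptic_psi w"
proof -
  have "elliptic_m' w' * (2 * w' - 1) \<le> elliptic_m' w' * (2 * w - 1)"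
    using elliptic_m'_neg[of w'] assms by (intro mult_left_mono_neg) auto
  also have "\<dots> \<le> elliptic_m' w * (2 * w - 1)"
    using elliptic_m'_antimono[of w w'] assms by (intro mult_right_mono) auto
  finally show ?thesis unfolding elliptic_psi_def using elliptic_m_strict_antimono[of w w'] assms by simp
qed

text \<open>The integrand is the derivative of \<open>w sin \<theta> cos \<theta> / sqrt (1 - w sin\<^sup>2 \<theta>)\<close>.\<close>

lemma elliptic_E_over_complement:
  assumes w: "w < 1"
  shows "((\<lambda>\<theta>. sqrt (1 - w * (sin \<theta>)^2) - (1 - w) / sqrt (1 - w * (sin \<theta>)^2) ^ 3) has_integral 0) {0..pi/2}"
proof -
  let ?h = "\<lambda>\<theta>. w * sin \<theta> * cos \<theta> / sqrt (1 - w * (sin \<theta>)^2)"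
  have "((\<lambda>\<theta>. sqrt (1 - w * (sin \<theta>)^2) - (1 - w) / sqrt (1 - w * (sin \<theta>)^2) ^ 3) has_integral (?h (pi/2) - ?h 0)) {0..pi/2}"
  proof (rule fundamental_theorem_of_calculus)
    fix x :: real
    define y where "y = sqrt (1 - w * (sin x)^2)"
    have y: "y > 0" "y^2 = 1 - w * (sin x)^2" using parameter_pos[OF w] by (auto simp: y_def less_imp_le)
    have dy: "((\<lambda>x. sqrt (1 - w * (sin x)^2)) has_real_derivative - w * sin x * cos x / y) (at x)"
    proof -
      have "((\<lambda>x. 1 - w * (sin x)^2) has_real_derivative - (2 * w * sin x * cos x)) (at x)"
        by (auto intro!: derivative_eq_intros)
      from DERIV_chain2[where f = sqrt and g = "\<lambda>x. 1 - w * (sin x)^2", OF DERIV_real_sqrt[OF parameter_pos[OF w]] this]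
      show ?thesis by (rule DERIV_cong) (simp add: y_def field_simps)
    qed
    have dn: "((\<lambda>x. w * sin x * cos x) has_real_derivative (w * cos x) * cos x + w * sin x * (- sin x)) (at x)"
      by (auto intro!: derivative_eq_intros)
    have "sqrt (1 - w * (sin x)^2) \<noteq> 0" using y(1) by (simp add: y_def)
    from DERIV_divide[OF dn dy this]
    have "(?h has_real_derivative (((w * cos x) * cos x + w * sin x * (- sin x)) * y - w * sin x * cos x * (- w * sin x * cos x / y)) / (y * y)) (at x)"
      unfolding y_def .
    also have "(((w * cos x) * cos x + w * sin x * (- sin x)) * y - w * sin x * cos x * (- w * sin x * cos x / y)) / (y * y)
       = y - (1 - w) / y ^ 3"
    proof -
      have "(w * cos x * cos x + w * sin x * (- sin x)) * y^2 + w^2 * (sin x)^2 * (cos x)^2 = y^2 * y^2 - (1 - w)"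
        unfolding y(2) using sin_cos_squared_add[of x] by algebra
      then show ?thesis using y(1) by (simp add: field_simps power2_eq_square power3_eq_cube)
    qed
    finally show "(?h has_vector_derivative sqrt (1 - w * (sin x)^2) - (1 - w) / sqrt (1 - w * (sin x)^2) ^ 3) (at x within {0..pi/2})"
      unfolding has_real_derivative_iff_has_vector_derivative y_def by (rule has_vector_derivative_at_within)
  qed simp
  then show ?thesis by simp
qed

text \<open>\<open>elliptic_m'\<close> involves the integral \<open>P\<close> of the inverse cube,
  which is neither K nor E; the identity \<open>(1 - w) * P = E\<close> eliminates it. In the
  prefactor, \<open>w\<close> turns \<open>w * (sin \<theta>)^2\<close> into one minus the radicand,
  \<open>1 - w\<close> serves that identity, and 2 clears the halves.\<close>

lemma f_aux_eq:
  assumes q: "0 < q" "q < 1"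
  shows "f_aux q = 2 * q^2 * (1 - q^2) * elliptic_psi (q^2)"
proof -
  define w where "w = q^2"
  have w: "0 < w" "w < 1" using q by (auto simp: w_def power_less_one_iff abs_square_less_1)
  define E where "E = integral {0..pi/2} (\<lambda>\<theta>. sqrt (1 - w * (sin \<theta>)^2))"
  define K where "K = integral {0..pi/2} (\<lambda>\<theta>. 1 / sqrt (1 - w * (sin \<theta>)^2))"
  define P where "P = integral {0..pi/2} (\<lambda>\<theta>. 1 / sqrt (1 - w * (sin \<theta>)^2) ^ 3)"
  note c = continuous_on_elliptic_integrands[OF w(2)]
  have hE: "((\<lambda>\<theta>. sqrt (1 - w * (sin \<theta>)^2)) has_integral E) {0..pi/2}"
    and hK: "((\<lambda>\<theta>. 1 / sqrt (1 - w * (sin \<theta>)^2)) has_integral K) {0..pi/2}"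
    and hP: "((\<lambda>\<theta>. 1 / sqrt (1 - w * (sin \<theta>)^2) ^ 3) has_integral P) {0..pi/2}"
    unfolding E_def K_def P_def by (intro integrable_integral integrable_continuous_real c)+
  have EK: "ellEc q = E" "ellK q = K"
    by (simp_all add: ellEc_def ellE_def ellK_def ellF_def sint_def E_def K_def w_def)
  have m: "elliptic_m w = 2 * E - K" using elliptic_m_eq[of q] q EK by (simp add: w_def)
  have P: "(1 - w) * P = E"
  proof -
    have "((\<lambda>\<theta>. sqrt (1 - w * (sin \<theta>)^2) - (1 - w) * (1 / sqrt (1 - w * (sin \<theta>)^2) ^ 3)) has_integral (E - (1 - w) * P)) {0..pi/2}"
      by (intro has_integral_diff has_integral_mult_right hE hP)
    then have "((\<lambda>\<theta>. sqrt (1 - w * (sin \<theta>)^2) - (1 - w) / sqrt (1 - w * (sin \<theta>)^2) ^ 3) has_integral (E - (1 - w) * P)) {0..pi/2}"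
      unfolding times_divide_eq_right mult_1_right .
    from has_integral_unique[OF this elliptic_E_over_complement[OF w(2)]] show ?thesis by simp
  qed
  have m': "w * elliptic_m' w = E - K / 2 - P / 2"
  proof -
    have "((\<lambda>\<theta>. sqrt (1 - w * (sin \<theta>)^2) - 1 / sqrt (1 - w * (sin \<theta>)^2) / 2 - 1 / sqrt (1 - w * (sin \<theta>)^2) ^ 3 / 2)
        has_integral (E - K / 2 - P / 2)) {0..pi/2}"
      by (intro has_integral_diff has_integral_divide hE hK hP)
    moreover have eq: "sqrt (1 - w * (sin \<theta>)^2) - 1 / sqrt (1 - w * (sin \<theta>)^2) / 2 - 1 / sqrt (1 - w * (sin \<theta>)^2) ^ 3 / 2
       = w * (- ((sin \<theta>)^2) * (1 / sqrt (1 - w * (sin \<theta>)^2) + 1 / (2 * sqrt (1 - w * (sin \<theta>)^2) ^ 3)))" for \<theta>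
    proof -
      define y where "y = sqrt (1 - w * (sin \<theta>)^2)"
      have y: "y > 0" "w * (sin \<theta>)^2 = 1 - y^2" using parameter_pos[OF w(2)] by (auto simp: y_def less_imp_le)
      have "w * (- ((sin \<theta>)^2) * (1 / y + 1 / (2 * y ^ 3))) = - (w * (sin \<theta>)^2) * (1 / y + 1 / (2 * y ^ 3))"
        by simp
      also have "\<dots> = y - 1 / y / 2 - 1 / y ^ 3 / 2"
        unfolding y(2) using y(1) by (simp add: field_simps power2_eq_square power3_eq_cube)
      finally show ?thesis unfolding y_def by simp
    qed
    ultimately have "((\<lambda>\<theta>. w * (- ((sin \<theta>)^2) * (1 / sqrt (1 - w * (sin \<theta>)^2) + 1 / (2 * sqrt (1 - w * (sin \<theta>)^2) ^ 3))))
        has_integral (E - K / 2 - P / 2)) {0..pi/2}"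
      unfolding eq by blast
    then show ?thesis
      unfolding elliptic_m'_def integral_mult_right[symmetric] by (rule integral_unique)
  qed
  have "2 * w * (1 - w) * elliptic_psi w = 2 * (1 - w) * (2 * w - 1) * (w * elliptic_m' w) + 2 * w * (1 - w) * elliptic_m w"
    unfolding elliptic_psi_def by (simp add: algebra_simps)
  also have "\<dots> = (2 * w - 1) * (2 * (1 - w) * E - (1 - w) * K - (1 - w) * P) + 2 * w * (1 - w) * (2 * E - K)"
    unfolding m m' by (simp add: field_simps)
  also have "\<dots> = (4 * w^2 - 5 * w + 1) * K + (- 8 * w^2 + 8 * w - 1) * E"
    unfolding P by (simp add: algebra_simps power2_eq_square)
  also have "\<dots> = f_aux q"
    unfolding f_aux_def EK by (simp add: w_def flip: power_mult)
  finally show ?thesis by (simp add: w_def)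
qed

section \<open>The moduli of the arcs and the loop\<close>

definition elliptic_G :: "real \<Rightarrow> real" where
  "elliptic_G w = 8 * (elliptic_m w)^2 * (2 * w - 1)"

lemma elliptic_m_isCont: "w < 1 \<Longrightarrow> isCont elliptic_m w"
  by (rule DERIV_isCont[OF elliptic_m_has_derivative])

lemma elliptic_G_has_derivative:
  assumes "w < 1"
  shows "(elliptic_G has_real_derivative 16 * elliptic_m w * elliptic_psi w) (at w)"
  unfolding elliptic_G_def[abs_def] elliptic_psi_def
  by (rule derivative_eq_intros elliptic_m_has_derivative[OF assms] refl)+
    (simp add: power2_eq_square algebra_simps)

lemma elliptic_G_continuous:
  assumes "b < 1"
  shows "continuous_on {a..b} elliptic_G"
  by (rule DERIV_continuous_on[where D = "\<lambda>w. 16 * elliptic_m w * elliptic_psi w"], rule has_field_derivative_at_within,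
      rule elliptic_G_has_derivative) (use assms in auto)

lemma g_aux_sqrt:
  assumes "0 \<le> w" "w < 1"
  shows "g_aux (sqrt w) = elliptic_G w" "2 * ellEc (sqrt w) - ellK (sqrt w) = elliptic_m w"
  using elliptic_m_eq[of "sqrt w"] assms by (simp_all add: g_aux_def elliptic_G_def)

text \<open>The bound 3/4 keeps \<open>2 * w - 1\<close> at least 1/2, so that large negative values
  of \<open>elliptic_m\<close> force large values of \<open>elliptic_G\<close>.\<close>

lemma elliptic_m_unbounded_below:
  assumes "0 \<le> C"
  shows "\<exists>w. 3/4 \<le> w \<and> w < 1 \<and> elliptic_m w \<le> - C"
proof -
  \<comment> \<open>Chosen to make \<open>pi + ln r = - C\<close> in the logarithmic bound.\<close>
  define r where "r = exp (- (pi + C))"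
  have "3 \<le> exp (pi + C)" using exp_ge_add_one_self[of "pi + C"] pi_ge_two assms by linarith
  then have "inverse (exp (pi + C)) \<le> inverse 2" by (intro le_imp_inverse_le) auto
  then have r: "0 < r" "r \<le> 1/2" unfolding r_def exp_minus by (simp_all add: inverse_eq_divide)
  have "r^2 \<le> (1/2)^2" using r by (intro power_mono) auto
  moreover have "0 < r^2" using r by simp
  moreover have "elliptic_m (1 - r^2) \<le> - C"
  proof -
    have "pi + ln r = - C" by (simp add: r_def)
    then show ?thesis using elliptic_m_le_ln[of r] r by linarith
  qed
  ultimately show ?thesis by (intro exI[of _ "1 - r^2"]) (auto simp: power2_eq_square)
qed

lemma inv_sqrt_two: "1 / sqrt 2 = sqrt (1 / 2)"
  by (simp add: real_sqrt_divide)

lemma as_sqrt: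
  fixes q :: real
  assumes "0 \<le> q"
  obtains w where "0 \<le> w" "q = sqrt w"
  using assms that[of "q^2"] by simp

text \<open>Both zeros come from sign changes: \<open>elliptic_m\<close> is positive at 1/2 and
  negative near 1, while \<open>elliptic_psi\<close> equals \<open>elliptic_m\<close> at 1/2 and
  reduces to a negative term at \<open>ws\<close>. Strict monotonicity gives the uniqueness that
  evaluates the two definite descriptions.\<close>

lemma elliptic_critical_parameters:
  obtains wh ws where "1/2 < wh" "wh < ws" "ws < 1" "elliptic_m ws = 0" "elliptic_psi wh = 0"
    "q_star = sqrt ws" "q_hat = sqrt wh"
proof -
  obtain b where b: "3/4 \<le> b" "b < 1" "elliptic_m b \<le> - 1"
    using elliptic_m_unbounded_below[of 1] by auto
  have "\<exists>x. 1/2 \<le> x \<and> x \<le> b \<and> elliptic_m x = 0"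
  proof (rule IVT2)
    show "\<forall>x. 1/2 \<le> x \<and> x \<le> b \<longrightarrow> isCont elliptic_m x" using elliptic_m_isCont b by auto
  qed (use b elliptic_m_half_pos in auto)
  then obtain ws where ws: "1/2 \<le> ws" "ws \<le> b" "elliptic_m ws = 0" by blast
  have "ws \<noteq> 1/2" using ws(3) elliptic_m_half_pos by (metis less_irrefl)
  then have ws': "1/2 < ws" "ws < 1" using ws b by linarith+
  have "continuous_on {1/2..ws} elliptic_psi"
    unfolding elliptic_psi_def[abs_def]
    by (intro continuous_intros continuous_on_subset[OF continuous_on_elliptic_m'[of ws]] continuous_at_imp_continuous_on)
      (use ws' elliptic_m_isCont in auto)
  moreover have "elliptic_psi ws \<le> 0"
    unfolding elliptic_psi_def using ws(3) elliptic_m'_neg[of ws] ws' by (simp add: mult_nonpos_nonneg)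
  moreover have "0 \<le> elliptic_psi (1/2)"
    unfolding elliptic_psi_def using elliptic_m_half_pos by simp
  ultimately obtain wh where wh: "1/2 \<le> wh" "wh \<le> ws" "elliptic_psi wh = 0"
    using IVT2'[of elliptic_psi ws 0 "1/2"] ws by auto
  have "elliptic_psi (1/2) \<noteq> 0" using elliptic_m_half_pos by (simp add: elliptic_psi_def)
  then have "wh \<noteq> 1/2" using wh(3) by metis
  moreover have "wh \<noteq> ws"
    using wh(3) ws(3) elliptic_m'_neg[of ws] ws' by (auto simp: elliptic_psi_def)
  ultimately have wh': "1/2 < wh" "wh < ws" using wh by auto
  have "q_star = sqrt ws"
    unfolding q_star_def
  proof (rule the_equality)
    show "0 < sqrt ws \<and> sqrt ws < 1 \<and> 2 * ellEc (sqrt ws) - ellK (sqrt ws) = 0"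
      using g_aux_sqrt(2)[of ws] ws ws' by simp
    fix q assume q: "0 < q \<and> q < 1 \<and> 2 * ellEc q - ellK q = 0"
    obtain w where w: "0 \<le> w" "q = sqrt w" using as_sqrt[of q] q by auto
    then have "w < 1" "elliptic_m w = 0" using q g_aux_sqrt(2)[of w] by auto
    then have "w = ws"
      using elliptic_m_strict_antimono[of w ws] elliptic_m_strict_antimono[of ws w] ws ws' w by (cases w ws rule: linorder_cases) auto
    then show "q = sqrt ws" using w by simp
  qed
  moreover have "q_hat = sqrt wh"
    unfolding q_hat_def inv_sqrt_two
  proof (rule the_equality)
    show "sqrt (1/2) \<le> sqrt wh \<and> sqrt wh < 1 \<and> f_aux (sqrt wh) = 0"
      using f_aux_eq[of "sqrt wh"] wh wh' ws' by simp
    fix q assume q: "sqrt (1/2) \<le> q \<and> q < 1 \<and> f_aux q = 0"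
    then have "0 < q" using less_le_trans[of 0 "sqrt (1/2)" q] by simp
    then obtain w where w: "0 \<le> w" "q = sqrt w" using as_sqrt[of q] by auto
    then have w1: "1/2 \<le> w" "w < 1" using q by auto
    then have "elliptic_psi w = 0" using f_aux_eq[of "sqrt w"] q w by simp
    then have "w = wh"
      using elliptic_psi_strict_antimono[of w wh] elliptic_psi_strict_antimono[of wh w] wh wh' w1 ws'
      by (cases w wh rule: linorder_cases) auto
    then show "q = sqrt wh" using w by simp
  qed
  ultimately show ?thesis using that wh wh' ws ws' by blast
qed

text \<open>The derivative is \<open>16 * elliptic_m w * elliptic_psi w\<close>;
  \<open>elliptic_psi\<close> changes sign at \<open>wh\<close> and \<open>elliptic_m\<close> at
  \<open>ws\<close>, which yields the pattern increasing, decreasing, increasing.\<close>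

lemma elliptic_G_monotonicity:
  assumes "1/2 < wh" "wh < ws" "ws < 1" "elliptic_m ws = 0" "elliptic_psi wh = 0"
  shows "\<lbrakk>1/2 \<le> x; x < y; y \<le> wh\<rbrakk> \<Longrightarrow> elliptic_G x < elliptic_G y"
    and "\<lbrakk>wh \<le> x; x < y; y \<le> ws\<rbrakk> \<Longrightarrow> elliptic_G y < elliptic_G x"
    and "\<lbrakk>ws \<le> x; x < y; y < 1\<rbrakk> \<Longrightarrow> elliptic_G x < elliptic_G y"
proof -
  have m_pos: "0 < elliptic_m z" if "0 \<le> z" "z < ws" for z
    using elliptic_m_strict_antimono[of z ws] that assms by simp
  have m_neg: "elliptic_m z < 0" if "ws < z" "z < 1" for z
    using elliptic_m_strict_antimono[of ws z] that assms by simp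
  have psi_pos: "0 < elliptic_psi z" if "1/2 \<le> z" "z < wh" for z
    using elliptic_psi_strict_antimono[of z wh] that assms by simp
  have psi_neg: "elliptic_psi z < 0" if "wh < z" "z < 1" for z
    using elliptic_psi_strict_antimono[of wh z] that assms by simp
  show "elliptic_G x < elliptic_G y" if "1/2 \<le> x" "x < y" "y \<le> wh"
  proof (rule DERIV_pos_imp_increasing_open[OF that(2)])
    fix z assume z: "x < z" "z < y"
    have "0 < 16 * elliptic_m z * elliptic_psi z"
      using m_pos[of z] psi_pos[of z] z that assms by auto
    moreover have "z < 1" using z that assms by linarith
    ultimately show "\<exists>D. (elliptic_G has_real_derivative D) (at z) \<and> 0 < D"
      using elliptic_G_has_derivative by blast
  qed (use that assms in \<open>auto intro: elliptic_G_continuous\<close>)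
  show "elliptic_G y < elliptic_G x" if "wh \<le> x" "x < y" "y \<le> ws"
  proof (rule DERIV_neg_imp_decreasing_open[OF that(2)])
    fix z assume z: "x < z" "z < y"
    have "16 * elliptic_m z * elliptic_psi z < 0"
      using m_pos[of z] psi_neg[of z] z that assms by (intro mult_pos_neg) auto
    moreover have "z < 1" using z that assms by linarith
    ultimately show "\<exists>D. (elliptic_G has_real_derivative D) (at z) \<and> D < 0"
      using elliptic_G_has_derivative by blast
  qed (use that assms in \<open>auto intro: elliptic_G_continuous\<close>)
  show "elliptic_G x < elliptic_G y" if "ws \<le> x" "x < y" "y < 1"
  proof (rule DERIV_pos_imp_increasing_open[OF that(2)])
    fix z assume z: "x < z" "z < y"
    have "0 < 16 * elliptic_m z * elliptic_psi z"
      using m_neg[of z] psi_neg[of z] z that assms by (intro mult_neg_neg) auto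
    moreover have "z < 1" using z that assms by linarith
    ultimately show "\<exists>D. (elliptic_G has_real_derivative D) (at z) \<and> 0 < D"
      using elliptic_G_has_derivative by blast
  qed (use that assms in \<open>auto intro: elliptic_G_continuous\<close>)
qed

text \<open>Continuity gives a solution and monotonicity its uniqueness, so the definite description
  denotes it. The sign of 2E - K is recorded because it makes \<open>arc_alpha\<close>
  positive.\<close>

lemma q1_spec:
  assumes c: "0 < c" "c \<le> lambda_hat"
  shows "0 < q1 c" "q1 c < 1" "0 < 2 * ellEc (q1 c) - ellK (q1 c)" "g_aux (q1 c) = c"
proof -
  obtain wh ws where w: "1/2 < wh" "wh < ws" "ws < 1" "elliptic_m ws = 0" "elliptic_psi wh = 0"
    "q_star = sqrt ws" "q_hat = sqrt wh" by (rule elliptic_critical_parameters)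
  note mono = elliptic_G_monotonicity[OF w(1-5)]
  have l: "lambda_hat = elliptic_G wh" unfolding lambda_hat_def w(7) by (rule g_aux_sqrt) (use w in auto)
  have G_half: "elliptic_G (1/2) = 0" by (simp add: elliptic_G_def)
  have "\<exists>x\<ge>1/2. x \<le> wh \<and> elliptic_G x = c"
    by (rule IVT') (use c l w(1-5) G_half in \<open>auto intro: elliptic_G_continuous\<close>)
  then obtain x where x: "1/2 \<le> x" "x \<le> wh" "elliptic_G x = c" by blast
  then have "x \<noteq> 1/2" using c G_half by (metis less_irrefl)
  then have x': "1/2 < x" using x by linarith
  have "q1 c = sqrt x"
    unfolding q1_def inv_sqrt_two w(7)
  proof (rule the_equality)
    show "sqrt (1/2) < sqrt x \<and> sqrt x \<le> sqrt wh \<and> g_aux (sqrt x) = c"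
      using g_aux_sqrt(1)[of x] x x' w(1-5) by simp
    fix q assume q: "sqrt (1/2) < q \<and> q \<le> sqrt wh \<and> g_aux q = c"
    then have "0 < q" using less_trans[of 0 "sqrt (1/2)" q] by simp
    then obtain y where y: "0 \<le> y" "q = sqrt y" using as_sqrt[of q] by auto
    then have y1: "1/2 < y" "y \<le> wh" using q by auto
    then have "elliptic_G y = c" using g_aux_sqrt(1)[of y] q y y1 w(1-5) by simp
    then have "y = x"
      using mono(1)[of x y] mono(1)[of y x] x y1 by (cases x y rule: linorder_cases) auto
    then show "q = sqrt x" using y by simp
  qed
  moreover have "0 < elliptic_m x"
    using elliptic_m_strict_antimono[of x ws] x w by simp
  ultimately show "0 < q1 c" "q1 c < 1" "0 < 2 * ellEc (q1 c) - ellK (q1 c)" "g_aux (q1 c) = c"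
    using g_aux_sqrt[of x] x x' w(1-5) by simp_all
qed

lemma q2_spec:
  assumes c: "0 < c" "c \<le> lambda_hat"
  shows "0 < q2 c" "q2 c < 1" "0 < 2 * ellEc (q2 c) - ellK (q2 c)" "g_aux (q2 c) = c"
proof -
  obtain wh ws where w: "1/2 < wh" "wh < ws" "ws < 1" "elliptic_m ws = 0" "elliptic_psi wh = 0"
    "q_star = sqrt ws" "q_hat = sqrt wh" by (rule elliptic_critical_parameters)
  note mono = elliptic_G_monotonicity[OF w(1-5)]
  have l: "lambda_hat = elliptic_G wh" unfolding lambda_hat_def w(7) by (rule g_aux_sqrt) (use w in auto)
  have "\<exists>x\<ge>wh. x \<le> ws \<and> elliptic_G x = c"
    by (rule IVT2') (use c l w in \<open>auto intro: elliptic_G_continuous simp: elliptic_G_def[of ws]\<close>)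
  then obtain x where x: "wh \<le> x" "x \<le> ws" "elliptic_G x = c" by blast
  \<comment> \<open>\<open>elliptic_G\<close> vanishes at \<open>ws\<close>, so \<open>c > 0\<close>
    excludes this endpoint, as the half-open range in \<open>q2\<close> requires.\<close>
  then have x': "x < ws" using c w by (auto simp: less_le elliptic_G_def)
  have "q2 c = sqrt x"
    unfolding q2_def w(6,7)
  proof (rule the_equality)
    show "sqrt wh \<le> sqrt x \<and> sqrt x < sqrt ws \<and> g_aux (sqrt x) = c"
      using g_aux_sqrt(1)[of x] x x' w(1-5) by simp
    fix q assume q: "sqrt wh \<le> q \<and> q < sqrt ws \<and> g_aux q = c"
    then have "0 < q" using less_le_trans[of 0 "sqrt wh" q] w(1-3) by simp
    then obtain y where y: "0 \<le> y" "q = sqrt y" using as_sqrt[of q] by auto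
    then have y1: "wh \<le> y" "y < ws" using q by auto
    then have "elliptic_G y = c" using g_aux_sqrt(1)[of y] q y y1 w(1-5) by simp
    then have "y = x"
      using mono(2)[of x y] mono(2)[of y x] x y1 by (cases x y rule: linorder_cases) auto
    then show "q = sqrt x" using y by simp
  qed
  moreover have "0 < elliptic_m x"
    using elliptic_m_strict_antimono[of x ws] x x' w(1-5) by simp
  ultimately show "0 < q2 c" "q2 c < 1" "0 < 2 * ellEc (q2 c) - ellK (q2 c)" "g_aux (q2 c) = c"
    using g_aux_sqrt[of x] x x' w(1-5) by simp_all
qed

lemma q3_spec:
  assumes c: "0 < c"
  shows "0 < q3 c" "q3 c < 1" "2 * ellEc (q3 c) - ellK (q3 c) < 0" "g_aux (q3 c) = c"
proof -
  obtain wh ws where w: "1/2 < wh" "wh < ws" "ws < 1" "elliptic_m ws = 0" "elliptic_psi wh = 0"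
    "q_star = sqrt ws" "q_hat = sqrt wh" by (rule elliptic_critical_parameters)
  note mono = elliptic_G_monotonicity[OF w(1-5)]
  \<comment> \<open>The value \<open>1 + c\<close> is used because its square exceeds
    \<open>c\<close> for every positive \<open>c\<close>; together with \<open>2 * b - 1\<close>
    being at least 1/2 and the factor 8 this puts \<open>elliptic_G b\<close> above
    \<open>c\<close>.\<close>
  obtain b where b: "3/4 \<le> b" "b < 1" "elliptic_m b \<le> - (1 + c)"
    using elliptic_m_unbounded_below[of "1 + c"] c by auto
  have wsb: "ws < b"
    using elliptic_m_strict_antimono[of b ws] b c w by (cases b ws rule: linorder_cases) auto
  have "(1 + c)^2 \<le> (- elliptic_m b)^2" using b c by (intro power_mono) auto
  then have "c * (1/2) \<le> (elliptic_m b)^2 * (2 * b - 1)"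
  proof (intro mult_mono)
    have "c \<le> (1 + c)^2" using c by (simp add: power2_eq_square algebra_simps add_pos_pos)
    then show "c \<le> (elliptic_m b)^2" using \<open>(1 + c)^2 \<le> (- elliptic_m b)^2\<close> by simp
  qed (use b in auto)
  then have Gb: "c \<le> elliptic_G b" using c unfolding elliptic_G_def by linarith
  have "\<exists>x\<ge>ws. x \<le> b \<and> elliptic_G x = c"
    by (rule IVT') (use c w b wsb Gb in \<open>auto intro: elliptic_G_continuous simp: elliptic_G_def[of ws]\<close>)
  then obtain x where x: "ws \<le> x" "x \<le> b" "elliptic_G x = c" by blast
  then have x': "ws < x" "x < 1" using c w b by (auto simp: less_le elliptic_G_def)
  have "q3 c = sqrt x"
    unfolding q3_def w(6)
  proof (rule the_equality)
    show "sqrt ws < sqrt x \<and> sqrt x < 1 \<and> g_aux (sqrt x) = c"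
      using g_aux_sqrt(1)[of x] x x' w(1-5) by simp
    fix q assume q: "sqrt ws < q \<and> q < 1 \<and> g_aux q = c"
    then have "0 < q" using less_trans[of 0 "sqrt ws" q] w(1-3) by simp
    then obtain y where y: "0 \<le> y" "q = sqrt y" using as_sqrt[of q] by auto
    then have y1: "ws < y" "y < 1" using q by auto
    then have "elliptic_G y = c" using g_aux_sqrt(1)[of y] q y y1 w(1-5) by simp
    then have "y = x"
      using mono(3)[of x y] mono(3)[of y x] x x' y1 by (cases x y rule: linorder_cases) auto
    then show "q = sqrt x" using y by simp
  qed
  moreover have "elliptic_m x < 0"
    using elliptic_m_strict_antimono[of ws x] x' w(1-5) by simp
  ultimately show "0 < q3 c" "q3 c < 1" "2 * ellEc (q3 c) - ellK (q3 c) < 0" "g_aux (q3 c) = c"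
    using g_aux_sqrt[of x] x x' w(1-5) by simp_all
qed

text \<open>Since \<open>\<alpha> * ell\<close> is \<open>4 * sg\<close> times 2E - K, squaring
  removes the sign and the right-hand side times \<open>ell^2\<close> is
  \<open>4 * g_aux q\<close>.\<close>

lemma lambda_from_g_aux:
  assumes "0 < ell" "sg = 1 \<or> sg = -1" "\<alpha> = 4 / ell * (sg * (2 * ellEc q - ellK q))" "g_aux q = lam * ell^2 / 4"
  shows "lam = 2 * \<alpha>^2 * (2 * q^2 - 1)"
proof -
  have "sg^2 = 1" using assms(2) by auto
  then have "2 * \<alpha>^2 * (2 * q^2 - 1) * ell^2 = 4 * g_aux q"
    unfolding assms(3) g_aux_def using assms(1) by (simp add: power_mult_distrib power_divide)
  also have "\<dots> = lam * ell^2" using assms(4) by simp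
  finally show ?thesis using assms(1) by simp
qed

lemma arc_not_local_minimizer:
  assumes "0 < ell" "0 < q" "q < 1" "0 < 2 * ellEc q - ellK q" "g_aux q = lam * ell^2 / 4"
    and "\<gamma> \<in> A_ell ell"
    and "arclength_param_is \<gamma> (arc_curve q (arc_alpha ell q)) (4 * ellK q / arc_alpha ell q)"
  shows "\<not> local_minimizer lam ell \<gamma>"
proof (rule wavelike_elastica_not_local_minimizer[where sg = 1 and \<alpha> = "arc_alpha ell q" and q = q])
  show "0 < arc_alpha ell q" using assms by (simp add: arc_alpha_def)
  show "lam = 2 * (arc_alpha ell q)\<^sup>2 * (2 * q\<^sup>2 - 1)"
    by (rule lambda_from_g_aux[of ell 1]) (use assms in \<open>auto simp: arc_alpha_def\<close>)
qed (use assms in \<open>auto simp: arc_alpha_def arc_curve_def fun_eq_iff\<close>)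

lemma loop_not_local_minimizer:
  assumes "0 < ell" "0 < q" "q < 1" "2 * ellEc q - ellK q < 0" "g_aux q = lam * ell^2 / 4"
    and "\<gamma> \<in> A_ell ell"
    and "arclength_param_is \<gamma> (loop_curve q (loop_alpha ell q)) (4 * ellK q / loop_alpha ell q)"
  shows "\<not> local_minimizer lam ell \<gamma>"
proof (rule wavelike_elastica_not_local_minimizer[where sg = "-1" and \<alpha> = "loop_alpha ell q" and q = q])
  show "0 < loop_alpha ell q" using assms by (simp add: loop_alpha_def)
  show "lam = 2 * (loop_alpha ell q)\<^sup>2 * (2 * q\<^sup>2 - 1)"
    by (rule lambda_from_g_aux[of ell "-1"]) (use assms in \<open>auto simp: loop_alpha_def\<close>)
  show "loop_curve q (loop_alpha ell q) = (\<lambda>s. (- 1 / loop_alpha ell q * (2 * ellE (am (loop_alpha ell q * s - ellK q) q) q + 2 * ellEc q - loop_alpha ell q * s),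
      1 / loop_alpha ell q * (2 * q * cn (loop_alpha ell q * s - ellK q) q)))"
  proof (rule ext)
    \<comment> \<open>The loop formula is the arc formula reflected in the vertical axis; the sign
      moves into the prefactor.\<close>
    have *: "1 / a * (- 2 * x - 2 * y + z) = - 1 / a * (2 * x + 2 * y - z)" for a x y z :: real
      by (simp add: divide_inverse algebra_simps)
    show "loop_curve q (loop_alpha ell q) s = (- 1 / loop_alpha ell q * (2 * ellE (am (loop_alpha ell q * s - ellK q) q) q + 2 * ellEc q - loop_alpha ell q * s),
      1 / loop_alpha ell q * (2 * q * cn (loop_alpha ell q * s - ellK q) q))" for s
      unfolding loop_curve_def * ..
  qed
qed (use assms in \<open>auto simp: loop_alpha_def\<close>)

theorem theorem3p8:
  fixes lam ell :: real and \<gamma> :: "real \<Rightarrow> real \<times> real"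
  assumes "lam > 0" and "ell > 0"
    and "penalized_pinned_elastica lam ell \<gamma>"
    and "(lam * ell^2 \<le> 4 * lambda_hat \<and>
            (arclength_param_is \<gamma> (gamma_sarc lam ell) (sarc_len lam ell) \<or>
             arclength_param_is \<gamma> (gamma_larc lam ell) (larc_len lam ell)))
         \<or> arclength_param_is \<gamma> (gamma_loop lam ell) (loop_len lam ell)"
  shows "\<not> local_minimizer lam ell \<gamma>"
proof -
  let ?c = "lam * ell^2 / 4"
  have c: "0 < ?c" using assms(1,2) by simp
  have \<gamma>: "\<gamma> \<in> A_ell ell" using assms(3) by (simp add: penalized_pinned_elastica_def)
  consider (sarc) "?c \<le> lambda_hat" "arclength_param_is \<gamma> (gamma_sarc lam ell) (sarc_len lam ell)"
    | (larc) "?c \<le> lambda_hat" "arclength_param_is \<gamma> (gamma_larc lam ell) (larc_len lam ell)"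
    | (loop) "arclength_param_is \<gamma> (gamma_loop lam ell) (loop_len lam ell)"
    using assms(4) by auto
  then show ?thesis
  proof cases
    case sarc
    show ?thesis
      by (rule arc_not_local_minimizer[OF assms(2) q1_spec[OF c sarc(1)] \<gamma>])
        (use sarc(2) in \<open>simp add: gamma_sarc_def sarc_len_def sarc_q_def\<close>)
  next
    case larc
    show ?thesis
      by (rule arc_not_local_minimizer[OF assms(2) q2_spec[OF c larc(1)] \<gamma>])
        (use larc(2) in \<open>simp add: gamma_larc_def larc_len_def larc_q_def\<close>)
  next
    case loop
    show ?thesis
      by (rule loop_not_local_minimizer[OF assms(2) q3_spec[OF c] \<gamma>])
        (use loop in \<open>simp add: gamma_loop_def loop_len_def loop_q_def\<close>)
  qed
qed

end
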